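(* Let $G=(V,E)$ be a finite, undirected, connected graph with no loops or parallel edges and with $n=|V|\ge 2$ vertices. Let $d_{\min}$ and $d_{\rm avg}$ be the minimum and average degrees of $G$, and let $t_{\rm hit}$ and $t_{\rm rel}$ be the maximum expected hitting time and the relaxation time of lazy random walk on $G$. Then $$t_{\rm hit}\le \frac{20\, d_{\rm avg}}{d_{\min}}\, n\,\sqrt{t_{\rm rel}+1}.$$
   Context: The degree of $x\in V$ is $d_x$. Lazy random walk (LRW) on $G$ is the discrete-time Markov chain $(X_t)_{t\ge 0}$ on $V$ with transition matrix $P(x,x)=\tfrac12$, $P(x,y)=\tfrac{1}{2d_x}$ if $xy\in E$, and $P(x,y)=0$ otherwise. It is irreducible and reversible with respect to its stationary distribution $\pi(x)=\frac{d_x}{d_{\rm avg}\,n}$, and its eigenvalues satisfy $1=\lambda_1>\lambda_2\ge\dots\ge\lambda_n\ge 0$. The relaxation time is $t_{\rm rel}:=(1-\lambda_2)^{-1}$. $\mathbb{E}_y$ denotes expectation when $X_0=y$; $\tau_x:=\inf\{t\ge 0: X_t=x\}$; and $t_{\rm hit}:=\max_{x,y\in V}\mathbb{E}_y[\tau_x]$. *)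

theory Defs
  imports
    "HOL-Probability.Probability"
    "Graph_Theory.Digraph_Component"
    "Jordan_Normal_Form.Char_Poly"
begin

section \<open>Markov chains on their canonical path space\<close>

definition chain_kernel :: "('a \<Rightarrow> 'a pmf) \<Rightarrow> 'a \<Rightarrow> nat \<Rightarrow> (nat \<Rightarrow> 'a) \<Rightarrow> 'a measure" where
  "chain_kernel K y t \<omega> = measure_pmf (if t = 0 then return_pmf y else K (\<omega> (t - 1)))"

interpretation chain: Ionescu_Tulcea "chain_kernel K y" "\<lambda>_. count_space UNIV" for K y
proof (rule Ionescu_Tulcea.intro)
  show "chain_kernel K y t \<in> measurable (PiM {0..<t} (\<lambda>_. count_space UNIV)) (subprob_algebra (count_space UNIV))" for t
  proof (cases t)
    case 0
    then show ?thesis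
      by (auto simp: chain_kernel_def[abs_def] space_subprob_algebra measure_pmf.subprob_space_axioms
               intro!: measurable_const)
  next
    case (Suc s)
    have "(\<lambda>\<omega>. \<omega> s) \<in> measurable (PiM {0..<t} (\<lambda>_. count_space UNIV)) (count_space UNIV)"
      using Suc by (intro measurable_component_singleton) auto
    moreover have "(\<lambda>x. measure_pmf (K x)) \<in> measurable (count_space UNIV) (subprob_algebra (count_space UNIV))"
      by (auto simp: space_subprob_algebra measure_pmf.subprob_space_axioms)
    ultimately have "(\<lambda>\<omega>. measure_pmf (K (\<omega> s))) \<in>
        measurable (PiM {0..<t} (\<lambda>_. count_space UNIV)) (subprob_algebra (count_space UNIV))"
      by (rule measurable_compose)
    then show ?thesis
      by (simp add: chain_kernel_def[abs_def] Suc)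
  qed
  show "prob_space (chain_kernel K y t \<omega>)" for t \<omega>
    unfolding chain_kernel_def by (rule measure_pmf.prob_space_axioms)
qed

text \<open>
  The law of the chain started at \<open>y\<close> on sequences \<open>\<omega>\<close>, with \<open>X\<^sub>t = \<omega> t\<close>;
  it is characterised by \<open>emeasure_path_measure_cylinder\<close> below.
\<close>

definition path_measure :: "('a \<Rightarrow> 'a pmf) \<Rightarrow> 'a \<Rightarrow> (nat \<Rightarrow> 'a) measure" where
  "path_measure K y = chain.PF.lim K y"

lemma space_path_measure [simp]: "space (path_measure K y) = UNIV"
  unfolding path_measure_def by (simp add: space_PiM)

lemma sets_path_measure [simp, measurable_cong]:
  "sets (path_measure K y) = sets (PiM UNIV (\<lambda>_. count_space UNIV))"
  unfolding path_measure_def by (rule chain.PF.sets_lim)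

lemma sets_PiM_singleton:
  "{restrict x {0..<n}} \<in> sets (PiM {0..<n::nat} (\<lambda>_. count_space UNIV))"
proof -
  have "{restrict x {0..<n}} = PiE {0..<n} (\<lambda>i. {x i})"
    by (auto simp: PiE_iff extensional_def restrict_def fun_eq_iff)
  also have "\<dots> \<in> sets (PiM {0..<n} (\<lambda>_. count_space UNIV))"
    by (intro sets_PiM_I_finite) auto
  finally show ?thesis .
qed

lemma emeasure_chain_C:
  "emeasure (chain.C K y 0 n (\<lambda>_. undefined)) {restrict x {0..<n}} =
     (\<Prod>i<n. emeasure (chain_kernel K y i (restrict x {0..<i})) {x i})"
proof (induction n)
  case 0
  have "restrict x {} = (\<lambda>_. undefined)"
    by (simp add: restrict_def)
  then show ?case
    using sets_PiM_singleton[of x 0] by simp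
next
  case (Suc n)
  let ?M = "\<lambda>n. PiM {0..<n::nat} (\<lambda>_. count_space (UNIV :: 'a set))"
  let ?C = "chain.C K y 0 n (\<lambda>_. undefined)"
  have sp: "(\<lambda>_. undefined) \<in> space (?M 0)"
    by (simp add: space_PiM)
  have sets_C: "sets ?C = sets (?M n)" and space_C: "space ?C = space (?M n)"
    using chain.sets_C[OF sp, of K y n] chain.space_C[OF sp, of K y n] by simp_all
  have *: "emeasure (chain.eP K y n \<omega>) {restrict x {0..<Suc n}} =
      emeasure (chain_kernel K y n (restrict x {0..<n})) {x n} * indicator {restrict x {0..<n}} \<omega>"
    if \<omega>: "\<omega> \<in> space (?M n)" for \<omega>
  proof -
    have "(\<lambda>z. fun_upd \<omega> n z) -` {restrict x {0..<Suc n}} =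
        (if \<omega> = restrict x {0..<n} then {x n} else {})"
      using \<omega> by (auto simp: space_PiM PiE_iff extensional_def restrict_def fun_eq_iff less_Suc_eq) (metis less_irrefl)+
    then show ?thesis
      by (subst chain.emeasure_eP[OF \<omega> sets_PiM_singleton]) (auto simp: indicator_def)
  qed
  have "emeasure (chain.C K y 0 (Suc n) (\<lambda>_. undefined)) {restrict x {0..<Suc n}} =
      (\<integral>\<^sup>+\<omega>. emeasure (chain.eP K y n \<omega>) {restrict x {0..<Suc n}} \<partial>?C)"
    using chain.measurable_eP[of K y n] sets_PiM_singleton[of x "Suc n"] chain.non_empty
    by (simp, subst emeasure_bind[where N = "?M (Suc n)"])
       (auto simp: space_C space_PiM measurable_cong_sets[OF sets_C refl] PiE_eq_empty_iff)
  also have "\<dots> = (\<integral>\<^sup>+\<omega>. emeasure (chain_kernel K y n (restrict x {0..<n})) {x n} *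
      indicator {restrict x {0..<n}} \<omega> \<partial>?C)"
    by (intro nn_integral_cong *) (simp add: space_C)
  also have "\<dots> = emeasure (chain_kernel K y n (restrict x {0..<n})) {x n} *
      emeasure ?C {restrict x {0..<n}}"
    using sets_PiM_singleton[of x n] by (subst nn_integral_cmult_indicator) (simp_all add: sets_C)
  finally show ?case
    by (simp only: Suc.IH prod.lessThan_Suc mult.commute)
qed

lemma emeasure_path_measure_cylinder:
  "emeasure (path_measure K y) {\<omega>. \<forall>i\<le>n. \<omega> i = x i} =
     (if x 0 = y then ennreal (\<Prod>i<n. pmf (K (x i)) (x (Suc i))) else 0)"
proof -
  let ?M = "\<lambda>_::nat. count_space (UNIV :: 'a set)"
  let ?X = "{restrict x {0..<Suc n}}"
  have "{\<omega>. \<forall>i\<le>n. \<omega> i = x i} = prod_emb UNIV ?M {0..<Suc n} ?X"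
    by (auto simp: prod_emb_def space_PiM restrict_def fun_eq_iff less_Suc_eq_le) metis
  then have "emeasure (path_measure K y) {\<omega>. \<forall>i\<le>n. \<omega> i = x i} = emeasure (chain.CI K y {0..<Suc n}) ?X"
    unfolding path_measure_def using chain.lim[OF _ sets_PiM_singleton, of "Suc n" K y x] by simp
  also have "\<dots> = emeasure (chain.C K y 0 (Suc n) (\<lambda>_. undefined))
      (prod_emb {0..<Suc n} ?M {0..<Suc n} ?X)"
    by (rule chain.emeasure_CI[OF _ sets_PiM_singleton]) simp
  also have "prod_emb {0..<Suc n} ?M {0..<Suc n} ?X = ?X"
    by (rule prod_emb_id) (auto simp: PiE_iff)
  also have "emeasure (chain.C K y 0 (Suc n) (\<lambda>_. undefined)) ?X =
      (\<Prod>i<Suc n. emeasure (chain_kernel K y i (restrict x {0..<i})) {x i})"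
    by (rule emeasure_chain_C)
  also have "\<dots> = emeasure (measure_pmf (return_pmf y)) {x 0} * (\<Prod>i<n. ennreal (pmf (K (x i)) (x (Suc i))))"
    by (subst prod.lessThan_Suc_shift) (simp add: chain_kernel_def emeasure_pmf_single)
  finally show ?thesis
    by (auto simp: emeasure_pmf_single prod_ennreal indicator_def)
qed

definition hitting_time :: "'a \<Rightarrow> (nat \<Rightarrow> 'a) \<Rightarrow> enat" where
  "hitting_time x \<omega> = Inf {enat t | t. \<omega> t = x}"

lemma measurable_hitting_time [measurable]:
  "hitting_time x \<in> measurable (PiM UNIV (\<lambda>_. count_space UNIV)) (count_space UNIV)"
proof -
  have [measurable]: "(\<lambda>\<omega>. \<omega> t) \<in> measurable (PiM UNIV (\<lambda>_::nat. count_space UNIV)) (count_space (UNIV :: 'a set))" for t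
    by (rule measurable_component_singleton) simp
  have "hitting_time x \<omega> = (INF t. if \<omega> t = x then enat t else \<infinity>)" for \<omega>
    unfolding hitting_time_def
    by (intro antisym INF_greatest Inf_greatest) (auto intro: Inf_lower INF_lower2)
  then have "hitting_time x = (\<lambda>\<omega>. INF t. if \<omega> t = x then enat t else \<infinity>)"
    by (simp add: fun_eq_iff)
  moreover have "(\<lambda>\<omega>. INF t. if \<omega> t = x then enat t else \<infinity>) \<in> measurable (PiM UNIV (\<lambda>_. count_space UNIV)) (count_space UNIV)"
    by measurable
  ultimately show ?thesis
    by simp
qed

definition expected_hitting_time :: "('a \<Rightarrow> 'a pmf) \<Rightarrow> 'a \<Rightarrow> 'a \<Rightarrow> ennreal" where
  "expected_hitting_time K y x = (\<integral>\<^sup>+\<omega>. ennreal_of_enat (hitting_time x \<omega>) \<partial>path_measure K y)"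


section \<open>Lazy random walk\<close>

text \<open>
  A finite simple undirected graph is a \<^locale>\<open>graph\<close>: a finite symmetric digraph without loops
  or parallel arcs, each edge \<open>xy\<close> being the pair of arcs \<open>x \<rightarrow> y\<close> and \<open>y \<rightarrow> x\<close>.
  The degree of a vertex is therefore its out-degree.
\<close>

definition d_min :: "('a, 'b) pre_digraph \<Rightarrow> nat" where
  "d_min G = Min (out_degree G ` verts G)"

definition d_avg :: "('a, 'b) pre_digraph \<Rightarrow> real" where
  "d_avg G = (\<Sum>x\<in>verts G. real (out_degree G x)) / real (card (verts G))"

definition lrw_prob :: "('a, 'b) pre_digraph \<Rightarrow> 'a \<Rightarrow> 'a \<Rightarrow> real" where
  "lrw_prob G x y =
     (if x = y then 1 / 2 else if x \<rightarrow>\<^bsub>G\<^esub> y then 1 / (2 * real (out_degree G x)) else 0)"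

text \<open>
  Meaningful when row \<open>x\<close> of the transition matrix sums to 1, i.e. when \<open>x\<close> has a neighbour;
  see \<open>pmf_lrw_step\<close>.
\<close>

definition lrw_step :: "('a, 'b) pre_digraph \<Rightarrow> 'a \<Rightarrow> 'a pmf" where
  "lrw_step G x = embed_pmf (lrw_prob G x)"

lemma out_degree_eq_card_neighbours:
  assumes "graph G"
  shows "out_degree G x = card {y. x \<rightarrow>\<^bsub>G\<^esub> y}"
proof -
  interpret graph G by fact
  have "bij_betw (head G) (out_arcs G x) {y. x \<rightarrow>\<^bsub>G\<^esub> y}"
    unfolding bij_betw_def
    by (auto simp: inj_on_def arcs_ends_conv intro: no_multi_arcs simp: arc_to_ends_def)
  then show ?thesis
    unfolding out_degree_def by (rule bij_betw_same_card)
qed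

lemma out_degree_pos:
  assumes "graph G" "Digraph_Component.connected G" "card (verts G) \<ge> 2" "x \<in> verts G"
  shows "out_degree G x > 0"
proof -
  interpret graph G by fact
  have "\<not> verts G \<subseteq> {x}"
    using card_mono[of "{x}" "verts G"] assms(3) by auto
  then obtain v where v: "v \<in> verts G" "v \<noteq> x"
    by auto
  have "x \<rightarrow>\<^sup>*\<^bsub>mk_symmetric G\<^esub> v"
    using assms(2,4) v by (auto simp: connected_def)
  then have "x \<rightarrow>\<^sup>*\<^bsub>G\<^esub> v"
    using reachable_mk_symmetric_eq sym_arcs by metis
  then obtain y where "x \<rightarrow>\<^bsub>G\<^esub> y"
    using v(2) by (auto elim: converse_reachable_cases)
  moreover have "finite {y. x \<rightarrow>\<^bsub>G\<^esub> y}"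
    by (rule finite_subset[OF _ finite_verts]) (auto dest: adj_in_verts)
  ultimately show ?thesis
    unfolding out_degree_eq_card_neighbours[OF assms(1)] by (auto simp: card_gt_0_iff)
qed

lemma pmf_lrw_step:
  assumes "graph G" "Digraph_Component.connected G" "card (verts G) \<ge> 2" "x \<in> verts G"
  shows "pmf (lrw_step G x) y = lrw_prob G x y"
proof -
  interpret graph G by fact
  let ?N = "{y. x \<rightarrow>\<^bsub>G\<^esub> y}"
  have N: "finite ?N" "x \<notin> ?N"
    using adj_not_same by (auto intro: finite_subset[OF _ finite_verts] dest: adj_in_verts)
  have "(\<integral>\<^sup>+y. ennreal (lrw_prob G x y) \<partial>count_space UNIV) = (\<Sum>y\<in>insert x ?N. ennreal (lrw_prob G x y))"
    using N by (intro nn_integral_count_space'[OF finite.insertI]) (auto simp: lrw_prob_def)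
  also have "\<dots> = ennreal (\<Sum>y\<in>insert x ?N. lrw_prob G x y)"
    by (rule sum_ennreal) (simp add: lrw_prob_def)
  also have "(\<Sum>y\<in>insert x ?N. lrw_prob G x y) = 1 / 2 + (\<Sum>y\<in>?N. 1 / (2 * real (out_degree G x)))"
    using N by (subst sum.insert) (auto simp: lrw_prob_def simp del: sum_constant intro!: sum.cong)
  also have "\<dots> = 1"
    using out_degree_pos[OF assms] by (simp add: out_degree_eq_card_neighbours[OF assms(1), symmetric])
  finally show ?thesis
    unfolding lrw_step_def by (intro pmf_embed_pmf) (auto simp: lrw_prob_def)
qed

definition t_hit :: "('a, 'b) pre_digraph \<Rightarrow> ennreal" where
  "t_hit G = Max {expected_hitting_time (lrw_step G) y x | x y. x \<in> verts G \<and> y \<in> verts G}"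

text \<open>
  The characteristic polynomial does not depend on the enumeration of the vertices chosen here.
\<close>

definition lrw_matrix :: "('a, 'b) pre_digraph \<Rightarrow> real Matrix.mat" where
  "lrw_matrix G =
     (let vs = (SOME vs. distinct vs \<and> set vs = verts G); n = card (verts G)
      in Matrix.mat n n (\<lambda>(i, j). lrw_prob G (vs ! i) (vs ! j)))"

text \<open>
  The eigenvalues with multiplicity in decreasing order, so that \<open>\<lambda>\<^sub>k\<close> is entry \<open>k - 1\<close>.
  All complex eigenvalues are real because the walk is reversible, so real roots suffice.
\<close>

definition lrw_eigenvalues :: "('a, 'b) pre_digraph \<Rightarrow> real list" where
  "lrw_eigenvalues G = rev (sorted_list_of_multiset (proots (char_poly (lrw_matrix G))))"

definition t_rel :: "('a, 'b) pre_digraph \<Rightarrow> real" where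
  "t_rel G = inverse (1 - lrw_eigenvalues G ! 1)"

end

theory Submission
  imports Defs
begin

text \<open>
  Write \<open>h\<close> for the function \<open>y \<mapsto> E\<^sub>y \<tau>\<^sub>x\<close>, \<open>m\<close> for its mean under the stationary law and
  \<open>N = d\<^sub>a\<^sub>v\<^sub>g n\<close> for the sum of the degrees. The argument avoids the transition semigroup and
  return probabilities: everything is read off from the equation \<open>(I - P) h = 1\<close> off \<open>x\<close>.
  Pairing it with \<open>h\<close> shows that the Dirichlet energy of \<open>h\<close> equals \<open>m\<close>, and a small energy
  makes \<open>h\<close> rigid in two ways.

  \<^item> Globally, the Poincare inequality bounds the variance of \<open>h\<close> by \<open>t\<^sub>r\<^sub>e\<^sub>l m\<close>. Hence on a set of
    stationary mass \<open>p\<close> where \<open>h \<le> m / 2\<close>, say, \<open>p m\<^sup>2 / 4 \<le> t\<^sub>r\<^sub>e\<^sub>l m\<close>.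

  \<^item> Locally, \<open>h x = 0\<close> and the Cauchy-Schwarz inequality along a geodesic give
    \<open>(h y)\<^sup>2 \<le> 2 N m dist x y\<close>, so \<open>h\<close> is small on a ball of radius \<open>R\<close> around \<open>x\<close>, and such a
    ball has at least about \<open>R d\<^sub>m\<^sub>i\<^sub>n / 3\<close> vertices.

  Choosing \<open>R\<close> of order \<open>\<surd>t\<^sub>r\<^sub>e\<^sub>l / d\<^sub>m\<^sub>i\<^sub>n\<close> balances the two and gives \<open>m \<le> 10 (N / d\<^sub>m\<^sub>i\<^sub>n) \<surd>(t\<^sub>r\<^sub>e\<^sub>l + 1)\<close>
  (lemma \<open>mean_sub_hitting_le\<close>). If \<open>\<surd>t\<^sub>r\<^sub>e\<^sub>l\<close> is at most a multiple of the degree of \<open>x\<close>, that radius may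
  be less than one; then the neighbours of \<open>x\<close> serve instead of a ball, because by Kac's formula \<open>h\<close>
  has average at most \<open>2 N / d\<^sub>x\<close> over them.

  The passage from the mean to the maximum costs a factor two: by symmetry of the Dirichlet form
  the energy pairing of two hitting functions computes a point value, and the energy of their sum
  is nonnegative (lemma \<open>hitting_function_le_means\<close>).

  Two bridges connect this to the probabilistic and spectral definitions. The truncated means
  \<open>E\<^sub>y min(\<tau>\<^sub>x, k)\<close> satisfy \<open>(I - P) f \<le> 1\<close> off \<open>x\<close>, which suffices for the bound on \<open>m\<close>; so they
  are bounded uniformly in \<open>k\<close> and converge to \<open>h\<close>. The best Poincare constant is attained, by
  compactness, at an eigenvector, and removing the constant functions by a change of basis shows
  that \<open>1\<close> is a simple root of the characteristic polynomial, so that the second entry of the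
  ordered list of eigenvalues is exactly one minus the spectral gap
  (lemma \<open>second_eigenvalue_walk\<close>).
\<close>

section \<open>Expected hitting times as sums of staying probabilities\<close>

text \<open>
  The probability that a chain started in \<open>S\<close> does not leave \<open>S\<close> during \<open>t\<close> steps, computed by
  conditioning on the first step; see \<open>emeasure_path_stay\<close>.
\<close>

primrec stay_prob :: "('a \<Rightarrow> 'a pmf) \<Rightarrow> 'a set \<Rightarrow> nat \<Rightarrow> 'a \<Rightarrow> real" where
  "stay_prob K S 0 y = 1"
| "stay_prob K S (Suc t) y = (\<Sum>z\<in>S. pmf (K y) z * stay_prob K S t z)"

lemma stay_prob_nonneg: "0 \<le> stay_prob K S t y"
  by (induction t arbitrary: y) (auto intro!: sum_nonneg)

lemma sum_words_Suc:
  assumes "finite S"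
  shows "(\<Sum>w | set w \<subseteq> S \<and> length w = Suc t. F w) = (\<Sum>z\<in>S. \<Sum>w | set w \<subseteq> S \<and> length w = t. F (z # w))"
proof -
  have "(\<Sum>w | set w \<subseteq> S \<and> length w = Suc t. F w) =
      (\<Sum>(z, w)\<in>S \<times> {w. set w \<subseteq> S \<and> length w = t}. F (z # w))"
    by (rule sum.reindex_bij_witness[of _ "\<lambda>(z, w). z # w" "\<lambda>w. (hd w, tl w)"])
      (auto simp: length_Suc_conv)
  then show ?thesis by (simp add: sum.cartesian_product)
qed

text \<open>
  Unfolding the recursion turns the staying probability into a sum over trajectories, which is
  what the cylinder formula for the path measure can be compared with.
\<close>

lemma stay_prob_eq_sum_words:
  assumes "finite S"
  shows "stay_prob K S t y = (\<Sum>w | set w \<subseteq> S \<and> length w = t. \<Prod>i<t. pmf (K ((y # w) ! i)) (w ! i))"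
proof (induction t arbitrary: y)
  case 0
  have "{w. set w \<subseteq> S \<and> length w = 0} = {[]}" by auto
  then show ?case by simp
next
  case (Suc t)
  show ?case
    unfolding sum_words_Suc[OF assms] prod.lessThan_Suc_shift
    by (simp add: Suc sum_distrib_left)
qed

lemma sets_cylinder: "{\<omega>. \<forall>i\<le>t. \<omega> i \<in> S i} \<in> sets (path_measure K y)"
proof -
  have [measurable]: "(\<lambda>\<omega>. \<omega> i \<in> S i) \<in> measurable (PiM UNIV (\<lambda>_::nat. count_space UNIV)) (count_space UNIV)" for i
    by (rule measurable_compose[OF measurable_component_singleton]) simp_all
  have "{\<omega> \<in> space (PiM UNIV (\<lambda>_. count_space UNIV)). \<forall>i\<le>t. \<omega> i \<in> S i} \<in> sets (PiM UNIV (\<lambda>_. count_space UNIV))"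
    by measurable
  then show ?thesis by (simp add: space_PiM)
qed

lemma prob_space_path_measure: "prob_space (path_measure K y)"
proof
  let ?M = "\<lambda>_::nat. count_space (UNIV :: 'a set)"
  interpret CI: prob_space "chain.CI K y {}" by (rule chain.PF.prob_space_P) simp_all
  have sp: "space (chain.CI K y {}) = space (PiM {} ?M)"
    by (rule chain.PF.space_P) simp_all
  have "prod_emb UNIV ?M {} (space (PiM {} ?M)) = UNIV"
    by (auto simp: prod_emb_def space_PiM)
  then show "emeasure (path_measure K y) (space (path_measure K y)) = 1"
    using chain.lim[of "{}" "space (PiM {} ?M)" K y] CI.emeasure_space_1
    by (simp add: sp path_measure_def[symmetric])
qed

text \<open>
  The event is a finite disjoint union of cylinders, one for each word over \<open>S\<close>; a word whose first
  letter is not the starting point contributes nothing.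
\<close>

lemma emeasure_path_stay:
  assumes S: "finite S" "y \<in> S"
  shows "emeasure (path_measure K y) {\<omega>. \<forall>i\<le>t. \<omega> i \<in> S} = ennreal (stay_prob K S t y)"
proof -
  let ?M = "path_measure K y"
  let ?W = "\<lambda>t. {w. set w \<subseteq> S \<and> length w = t}"
  let ?C = "\<lambda>w. {\<omega>. \<forall>i\<le>t. \<omega> i = w ! i}"
  have fin: "finite (?W n)" for n using S(1) by (rule finite_lists_length_eq)
  have "{\<omega>. \<forall>i\<le>t. \<omega> i \<in> S} = (\<Union>w\<in>?W (Suc t). ?C w)"
  proof (intro equalityI subsetI)
    fix \<omega> assume "\<omega> \<in> {\<omega>. \<forall>i\<le>t. \<omega> i \<in> S}"
    then show "\<omega> \<in> (\<Union>w\<in>?W (Suc t). ?C w)"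
      by (intro UN_I[of "map \<omega> [0..<Suc t]"]) (auto simp del: upt_Suc)
  qed (auto simp: subset_iff)
  moreover have "disjoint_family_on ?C (?W (Suc t))"
    unfolding disjoint_family_on_def
  proof (intro ballI impI)
    fix v w assume vw: "v \<in> ?W (Suc t)" "w \<in> ?W (Suc t)" "v \<noteq> w"
    then obtain i where "i \<le> t" "v ! i \<noteq> w ! i"
      by (metis (mono_tags, lifting) less_Suc_eq_le mem_Collect_eq nth_equalityI)
    then show "?C v \<inter> ?C w = {}" by force
  qed
  moreover have "?C w \<in> sets ?M" for w
    using sets_cylinder[of t "\<lambda>i. {w ! i}"] by simp
  ultimately have "emeasure ?M {\<omega>. \<forall>i\<le>t. \<omega> i \<in> S} = (\<Sum>w\<in>?W (Suc t). emeasure ?M (?C w))"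
    using fin by (simp add: sum_emeasure image_subset_iff)
  also have "\<dots> = (\<Sum>z\<in>S. \<Sum>w\<in>?W t. emeasure ?M (?C (z # w)))"
    by (rule sum_words_Suc[OF S(1)])
  also have "\<dots> = (\<Sum>z\<in>S. if z = y then ennreal (stay_prob K S t y) else 0)"
    by (intro sum.cong refl)
      (simp add: emeasure_path_measure_cylinder stay_prob_eq_sum_words[OF S(1)] sum_ennreal prod_nonneg)
  finally show ?thesis using S by simp
qed

lemma less_hitting_time_iff: "enat t < hitting_time x \<omega> \<longleftrightarrow> (\<forall>i\<le>t. \<omega> i \<noteq> x)"
proof
  assume *: "enat t < hitting_time x \<omega>"
  show "\<forall>i\<le>t. \<omega> i \<noteq> x"
  proof (intro allI impI notI)
    fix i assume "i \<le> t" "\<omega> i = x"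
    then have "hitting_time x \<omega> \<le> enat i"
      unfolding hitting_time_def by (intro Inf_lower) auto
    also have "\<dots> \<le> enat t" using \<open>i \<le> t\<close> by simp
    finally show False using * by simp
  qed
next
  assume *: "\<forall>i\<le>t. \<omega> i \<noteq> x"
  have "enat (Suc t) \<le> hitting_time x \<omega>"
    unfolding hitting_time_def
  proof (rule Inf_greatest)
    fix u assume "u \<in> {enat s |s. \<omega> s = x}"
    then obtain s where "u = enat s" "\<omega> s = x" by auto
    moreover from this * have "\<not> s \<le> t" by auto
    ultimately show "enat (Suc t) \<le> u" by simp
  qed
  then show "enat t < hitting_time x \<omega>" by (simp add: Suc_ile_eq)
qed

text \<open>
  Tail sum formula. Almost surely the chain does not leave \<open>V\<close>, so that \<open>\<tau>\<^sub>x > t\<close> is the event of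
  staying in the finite set \<open>V - {x}\<close>, whatever the size of the type of states.
\<close>

lemma expected_hitting_time_eq:
  assumes V: "finite V" "\<And>y. y \<in> V \<Longrightarrow> set_pmf (K y) \<subseteq> V" and y: "y \<in> V"
  shows "expected_hitting_time K y x = (\<Sum>t. ennreal (if y = x then 0 else stay_prob K (V - {x}) t y))"
proof -
  let ?M = "path_measure K y"
  have one: "stay_prob K V t z = 1" if "z \<in> V" for t z
    using that
  proof (induction t arbitrary: z)
    case (Suc t)
    then have "stay_prob K V (Suc t) z = (\<Sum>u\<in>V. pmf (K z) u)" by simp
    then show ?case using sum_pmf_eq_1[OF V(1) V(2)[OF Suc.prems]] by simp
  qed simp
  have tot: "emeasure ?M {\<omega>. \<forall>i\<le>t. \<omega> i \<in> V} = 1" for t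
    using emeasure_path_stay[OF V(1) y] one[OF y] by simp
  interpret prob_space ?M by (rule prob_space_path_measure)
  have stay: "AE \<omega> in ?M. \<forall>i\<le>t. \<omega> i \<in> V" for t
    using tot[of t] sets_cylinder[of t "\<lambda>_. V" K y] prob_Collect_eq_1[of "\<lambda>\<omega>. \<forall>i\<le>t. \<omega> i \<in> V"]
    by (simp add: emeasure_eq_measure)
  have start: "AE \<omega> in ?M. \<omega> 0 = y"
    using emeasure_path_stay[of "{y}" y K 0] sets_cylinder[of 0 "\<lambda>_. {y}" K y]
      prob_Collect_eq_1[of "\<lambda>\<omega>. \<omega> 0 = y"]
    by (simp add: emeasure_eq_measure)
  have "emeasure ?M {\<omega> \<in> space ?M. enat t < hitting_time x \<omega>}
      = ennreal (if y = x then 0 else stay_prob K (V - {x}) t y)" for t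
  proof -
    have "emeasure ?M {\<omega> \<in> space ?M. enat t < hitting_time x \<omega>}
      = emeasure ?M {\<omega>. \<forall>i\<le>t. \<omega> i \<in> V - {x}}"
      using sets_cylinder[of t "\<lambda>_. V - {x}" K y] sets_cylinder[of t "\<lambda>_. - {x}" K y]
      by (intro emeasure_eq_AE) (use stay[of t] in \<open>auto simp: less_hitting_time_iff\<close>)
    also have "\<dots> = ennreal (if y = x then 0 else stay_prob K (V - {x}) t y)"
    proof (cases "y = x")
      case True
      have "AE \<omega> in ?M. \<not> (\<forall>i\<le>t. \<omega> i \<in> V - {x})"
        using start by eventually_elim (use True in auto)
      then show ?thesis
        using True emeasure_eq_0_AE[of "\<lambda>\<omega>. \<forall>i\<le>t. \<omega> i \<in> V - {x}" ?M] by simp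
    next
      case False
      then show ?thesis using emeasure_path_stay[of "V - {x}" y K t] V(1) y by simp
    qed
    finally show ?thesis .
  qed
  moreover have "hitting_time x \<in> measurable ?M (count_space UNIV)"
    by measurable
  ultimately show ?thesis
    unfolding expected_hitting_time_def by (simp add: nn_integral_enat_function)
qed

section \<open>The Dirichlet form of a connected graph\<close>

text \<open>
  The analytic part only sees the neighbourhoods \<open>nb y\<close>. Sums weighted by degrees are kept
  unnormalised: the stationary law is \<open>deg y / vol\<close>, the operator \<open>lap\<close> equals \<open>2 deg y\<close> times
  \<open>I - P\<close> for the lazy walk, and accordingly \<open>energy\<close> is \<open>2 vol\<close> times the usual Dirichlet form
  of the walk.
\<close>

locale connected_graph =
  fixes V :: "'v set" and nb :: "'v \<Rightarrow> 'v set"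
  assumes finite_V: "finite V"
    and nb_subset: "\<And>y. y \<in> V \<Longrightarrow> nb y \<subseteq> V"
    and nb_sym: "\<And>y z. y \<in> V \<Longrightarrow> z \<in> nb y \<Longrightarrow> y \<in> nb z"
    and nb_irrefl: "\<And>y. y \<notin> nb y"
    and reach: "\<And>y z. y \<in> V \<Longrightarrow> z \<in> V \<Longrightarrow> (y, z) \<in> {(v, w). v \<in> V \<and> w \<in> nb v}\<^sup>*"
begin

lemma finite_nb: "y \<in> V \<Longrightarrow> finite (nb y)"
  using finite_subset[OF nb_subset finite_V] .

definition deg :: "'v \<Rightarrow> real" where "deg y = real (card (nb y))"

definition vol :: real where "vol = (\<Sum>y\<in>V. deg y)"

definition wsum :: "('v \<Rightarrow> real) \<Rightarrow> real" where "wsum f = (\<Sum>y\<in>V. deg y * f y)"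

definition mean :: "('v \<Rightarrow> real) \<Rightarrow> real" where "mean f = wsum f / vol"

definition lap :: "('v \<Rightarrow> real) \<Rightarrow> 'v \<Rightarrow> real" where
  "lap f y = (\<Sum>z\<in>nb y. f y - f z)"

definition energy :: "('v \<Rightarrow> real) \<Rightarrow> ('v \<Rightarrow> real) \<Rightarrow> real" where
  "energy f g = (\<Sum>y\<in>V. f y * lap g y)"

lemma deg_nonneg [simp]: "0 \<le> deg y"
  by (simp add: deg_def)

lemma lap_eq: "lap f y = deg y * f y - (\<Sum>z\<in>nb y. f z)"
  by (simp add: lap_def deg_def sum_subtractf)

lemma sum_edges_swap:
  "(\<Sum>y\<in>V. \<Sum>z\<in>nb y. F y z) = (\<Sum>y\<in>V. \<Sum>z\<in>nb y. F z y)" for F :: "'v \<Rightarrow> 'v \<Rightarrow> real"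
proof -
  have "(\<Sum>(y, z)\<in>Sigma V nb. F y z) = (\<Sum>(y, z)\<in>Sigma V nb. F z y)"
    by (rule sum.reindex_bij_witness[of _ prod.swap prod.swap])
      (use nb_sym nb_subset in \<open>fastforce\<close>)+
  then show ?thesis
    using finite_V finite_nb by (simp add: sum.Sigma)
qed

text \<open>
  Summation by parts. It makes the pairing of \<open>f\<close> with the Laplacian of \<open>g\<close> symmetric and
  its quadratic form nonnegative; the factor one half occurs because the sum visits every edge in
  both orientations.
\<close>

lemma green:
  "energy f g = (\<Sum>y\<in>V. \<Sum>z\<in>nb y. (f y - f z) * (g y - g z)) / 2"
proof -
  let ?S = "\<lambda>F. \<Sum>y\<in>V. \<Sum>z\<in>nb y. F y z"
  have 1: "energy f g = ?S (\<lambda>y z. f y * (g y - g z))"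
    by (simp add: energy_def lap_def sum_distrib_left)
  have 2: "\<dots> = ?S (\<lambda>y z. f z * (g z - g y))"
    by (rule sum_edges_swap)
  have "2 * energy f g = ?S (\<lambda>y z. f y * (g y - g z)) + ?S (\<lambda>y z. f z * (g z - g y))"
    using 1 2 by simp
  also have "\<dots> = ?S (\<lambda>y z. (f y - f z) * (g y - g z))"
    by (simp add: sum.distrib[symmetric] algebra_simps)
  finally show ?thesis by simp
qed

lemma energy_commute: "energy f g = energy g f"
  by (simp add: green mult.commute)

lemma energy_nonneg: "0 \<le> energy f f"
  unfolding green by (simp add: sum_nonneg)

lemma sum_lap: "(\<Sum>y\<in>V. lap f y) = 0"
proof -
  have "energy (\<lambda>_. 1) f = 0" by (simp add: green)
  then show ?thesis by (simp add: energy_def)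
qed

lemma lap_add: "lap (\<lambda>y. f y + c * g y) y = lap f y + c * lap g y"
  by (simp add: lap_def sum.distrib sum_distrib_left algebra_simps sum_subtractf)

lemma energy_add: "energy (\<lambda>y. f y + c * g y) (\<lambda>y. f y + c * g y)
   = energy f f + 2 * c * energy f g + c\<^sup>2 * energy g g"
proof -
  have "energy (\<lambda>y. f y + c * g y) (\<lambda>y. f y + c * g y) =
     energy f f + c * energy f g + c * energy g f + c\<^sup>2 * energy g g"
    by (simp add: energy_def lap_add sum.distrib sum_distrib_left algebra_simps power2_eq_square)
  then show ?thesis by (simp add: energy_commute[of g f])
qed

section \<open>Graph distance\<close>

primrec gball :: "'v \<Rightarrow> nat \<Rightarrow> 'v set" where
  "gball x 0 = {x}"
| "gball x (Suc k) = gball x k \<union> (\<Union>y\<in>gball x k. nb y)"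

definition gdist :: "'v \<Rightarrow> 'v \<Rightarrow> nat" where
  "gdist x y = (LEAST k. y \<in> gball x k)"

lemma gball_mono: "j \<le> k \<Longrightarrow> gball x j \<subseteq> gball x k"
  by (rule lift_Suc_mono_le[of "gball x"]) auto

lemma gball_exhausts:
  assumes "x \<in> V" "y \<in> V" shows "\<exists>k. y \<in> gball x k"
  using reach[OF assms]
proof (induction rule: rtrancl_induct)
  case base
  show ?case by (rule exI[of _ 0]) simp
next
  case (step y z)
  then obtain k where "y \<in> gball x k" by auto
  with step show ?case by (intro exI[of _ "Suc k"]) auto
qed

lemma gball_iff:
  assumes "x \<in> V" "y \<in> V" shows "y \<in> gball x k \<longleftrightarrow> gdist x y \<le> k"
proof -
  obtain j where "y \<in> gball x j"
    using gball_exhausts[OF assms] by auto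
  then have "y \<in> gball x (gdist x y)"
    unfolding gdist_def by (rule LeastI)
  then show ?thesis
    using gball_mono[of "gdist x y" k x] unfolding gdist_def by (auto intro: Least_le)
qed

lemma gdist_self [simp]: "gdist x x = 0"
  unfolding gdist_def by (rule Least_eq_0) simp

lemma gdist_nb:
  assumes "x \<in> V" "y \<in> V" "z \<in> nb y"
  shows "gdist x z \<le> Suc (gdist x y)"
proof -
  have "y \<in> gball x (gdist x y)" using assms by (simp add: gball_iff)
  then have "z \<in> gball x (Suc (gdist x y))" using assms by auto
  then show ?thesis using assms nb_subset by (subst (asm) gball_iff) auto
qed

lemma gball_subset: "x \<in> V \<Longrightarrow> gball x k \<subseteq> V"
  by (induction k) (use nb_subset in auto)

lemma gdist_pred:
  assumes "x \<in> V" "y \<in> V" "gdist x y = Suc k"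
  obtains w where "w \<in> V" "gdist x w = k" "y \<in> nb w"
proof -
  have "y \<in> gball x (Suc k)" "y \<notin> gball x k"
    using assms by (simp_all add: gball_iff del: gball.simps)
  then obtain w where w: "w \<in> gball x k" "y \<in> nb w" by auto
  then have "w \<in> V" using gball_subset assms by blast
  moreover have "gdist x w = k"
    using gdist_nb[OF assms(1) \<open>w \<in> V\<close> w(2)] w(1) assms \<open>w \<in> V\<close> by (simp add: gball_iff)
  ultimately show thesis using that w by blast
qed

text \<open>
  The distance grows by exactly one in each step, so that the edges of the path are pairwise
  distinct.
\<close>

lemma geodesic:
  assumes "x \<in> V" "y \<in> V" "gdist x y = k"
  obtains v where "v 0 = x" "v k = y" "\<And>i. i \<le> k \<Longrightarrow> v i \<in> V \<and> gdist x (v i) = i"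
    "\<And>i. i < k \<Longrightarrow> v (Suc i) \<in> nb (v i)"
  using assms(2,3)
proof (induction k arbitrary: y thesis)
  case 0
  then have "y = x" using gball_iff[OF assms(1) 0(2), of 0] by simp
  then show ?case using 0 assms(1) by (intro 0(1)[of "\<lambda>_. x"]) auto
next
  case (Suc k)
  obtain w where w: "w \<in> V" "gdist x w = k" "y \<in> nb w"
    using gdist_pred[OF assms(1) Suc.prems(2,3)] .
  obtain v where v: "v 0 = x" "v k = w" "\<And>i. i \<le> k \<Longrightarrow> v i \<in> V \<and> gdist x (v i) = i"
    "\<And>i. i < k \<Longrightarrow> v (Suc i) \<in> nb (v i)"
    using Suc.IH[OF _ w(1,2)] by metis
  show ?case
    by (rule Suc.prems(1)[of "v(Suc k := y)"])
      (use v w Suc.prems(2,3) in \<open>auto simp: le_Suc_eq less_Suc_eq\<close>)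
qed

text \<open>
  Effective resistance is at most graph distance: Cauchy-Schwarz along a geodesic. Both
  orientations of every edge of the path occur in the energy, which cancels the factor one half in
  Green's formula. Losing a factor two here would spoil the final constant.
\<close>

lemma sq_diff_le_gdist_energy:
  assumes "x \<in> V" "y \<in> V"
  shows "(f y - f x)\<^sup>2 \<le> real (gdist x y) * energy f f"
proof -
  define k where "k = gdist x y"
  obtain v where v: "v 0 = x" "v k = y" "\<And>i. i \<le> k \<Longrightarrow> v i \<in> V \<and> gdist x (v i) = i"
    "\<And>i. i < k \<Longrightarrow> v (Suc i) \<in> nb (v i)"
    using geodesic[OF assms k_def[symmetric]] by metis
  have tele: "f y - f x = (\<Sum>i<k. f (v (Suc i)) - f (v i))"
    using v(1,2) sum_lessThan_telescope[where f = "\<lambda>i. f (v i)" and m = k] by simp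
  have "(f y - f x)\<^sup>2 \<le> real k * (\<Sum>i<k. (f (v (Suc i)) - f (v i))\<^sup>2)"
    unfolding tele using sum_squared_le_sum_of_squares[of "\<lambda>i. f (v (Suc i)) - f (v i)" "{..<k}"]
    by (simp add: mult.commute)
  also have "(\<Sum>i<k. (f (v (Suc i)) - f (v i))\<^sup>2) \<le> energy f f"
  proof -
    let ?q = "\<lambda>(y, z). (f y - f z)\<^sup>2"
    let ?F = "(\<lambda>i. (v i, v (Suc i))) ` {..<k}" and ?B = "(\<lambda>i. (v (Suc i), v i)) ` {..<k}"
    have dist: "gdist x (v i) = i" "gdist x (v (Suc i)) = Suc i" if "i < k" for i
      using v(3)[of i] v(3)[of "Suc i"] that by auto
    have inj: "inj_on (\<lambda>i. (v i, v (Suc i))) {..<k}" "inj_on (\<lambda>i. (v (Suc i), v i)) {..<k}"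
      by (rule inj_onI, metis dist(1) lessThan_iff prod.inject)+
    have disj: "?F \<inter> ?B = {}"
    proof (rule ccontr)
      assume "?F \<inter> ?B \<noteq> {}"
      then obtain i j where ij: "i < k" "j < k" "v i = v (Suc j)" "v (Suc i) = v j"
        by auto
      have "i = Suc j" "Suc i = j"
        using ij dist[of i] dist[of j] by (metis, metis)
      then show False by simp
    qed
    have "2 * (\<Sum>i<k. (f (v (Suc i)) - f (v i))\<^sup>2) = sum ?q ?F + sum ?q ?B"
      by (subst (1 2) sum.reindex) (use inj in \<open>auto simp: power2_commute o_def\<close>)
    also have "\<dots> = sum ?q (?F \<union> ?B)"
      using disj by (intro sum.union_disjoint[symmetric]) auto
    also have "\<dots> \<le> sum ?q (Sigma V nb)"
      using v finite_V finite_nb nb_sym[OF conjunct1[OF v(3)] v(4)]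
      by (intro sum_mono2 finite_SigmaI) auto
    also have "\<dots> = 2 * energy f f"
      using finite_V finite_nb by (simp add: green sum.Sigma power2_eq_square)
    finally show ?thesis by simp
  qed
  finally show ?thesis by (simp add: k_def mult_left_mono)
qed

lemma gdist_intermediate:
  assumes "x \<in> V" "y \<in> V" "j \<le> gdist x y"
  obtains w where "w \<in> V" "gdist x w = j"
proof -
  obtain v where "\<And>i. i \<le> gdist x y \<Longrightarrow> v i \<in> V \<and> gdist x (v i) = i"
    using geodesic[OF assms(1,2) refl] by metis
  with assms that show thesis by blast
qed

text \<open>
  The closed neighbourhoods of vertices at distances \<open>0, 3, 6, \<dots>\<close> from \<open>x\<close> are disjoint,
  each has more than \<open>d\<close> elements, and together the first \<open>j + 1\<close> of them lie within distance
  \<open>3 j + 1\<close>.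
\<close>

lemma ball_growth:
  assumes x: "x \<in> V" and d: "\<And>y. y \<in> V \<Longrightarrow> d \<le> card (nb y)"
    and far: "w \<in> V" "3 * j + 1 \<le> gdist x w"
  shows "(j + 1) * (d + 1) \<le> card {y\<in>V. gdist x y \<le> 3 * j + 1}"
  using far(2)
proof (induction j)
  case 0
  have "d + 1 \<le> card (insert x (nb x))"
    using d[OF x] finite_nb[OF x] nb_irrefl by simp
  also have "\<dots> \<le> card {y\<in>V. gdist x y \<le> 3 * 0 + 1}"
    using x nb_subset[OF x] gdist_nb[OF x x] finite_V by (intro card_mono) auto
  finally show ?case by simp
next
  case (Suc j)
  let ?B = "\<lambda>j. {y\<in>V. gdist x y \<le> 3 * j + 1}"
  obtain u where u: "u \<in> V" "gdist x u = 3 * j + 3"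
    using gdist_intermediate[OF x far(1), of "3 * j + 3"] Suc.prems by auto
  have nbu: "gdist x z \<le> 3 * j + 4 \<and> 3 * j + 2 \<le> gdist x z" if "z \<in> nb u" for z
    using gdist_nb[OF x u(1) that] gdist_nb[OF x _ nb_sym[OF u(1) that]] nb_subset[OF u(1)] that u(2)
    by (auto simp: subset_iff)
  have "(Suc j + 1) * (d + 1) \<le> card (?B j) + card (insert u (nb u))"
    using Suc d[OF u(1)] finite_nb[OF u(1)] nb_irrefl by simp
  also have "\<dots> = card (?B j \<union> insert u (nb u))"
    using finite_V finite_nb[OF u(1)] u(2) nbu by (intro card_Un_disjoint[symmetric]) fastforce+
  also have "\<dots> \<le> card (?B (Suc j))"
    using finite_V u nb_subset[OF u(1)] nbu by (intro card_mono) fastforce+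
  finally show ?case .
qed

end

section \<open>The stationary mean of a hitting function\<close>

text \<open>
  The optimisation over the radius, with \<open>A = vol / d\<close>, \<open>s = \<surd>T\<close>, and \<open>q\<close> a lower bound for the
  number of vertices in the ball. Taking square roots gives
  \<open>\<surd>m \<le> \<surd>(6 q A) + s \<surd>(A / q)\<close>. The square of the right-hand side is \<open>A (6 q + s\<^sup>2 / q + 2 \<surd>6 s)\<close>,
  smallest at \<open>q = s / \<surd>6\<close>. As \<open>q\<close> is a multiple of the minimum degree it can only be
  chosen in a window; on \<open>[s / 3, s / 2]\<close> the first two terms sum to at most \<open>5 s\<close>.
\<close>

lemma mean_bound_from_ball_estimate:
  fixes A q s m :: real
  assumes A: "0 < A" and q: "0 < q" "2 * q \<le> s" "s \<le> 3 * q" and m: "0 < m"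
    and le: "q * (m - sqrt (6 * q * A * m))\<^sup>2 \<le> s\<^sup>2 * A * m"
  shows "m \<le> 10 * A * s"
proof -
  define r c e where "r = sqrt m" and "c = sqrt (6 * q * A)" and "e = s * sqrt (A / q)"
  have m_eq: "m = r\<^sup>2" and r: "0 < r" and c: "0 \<le> c" and e: "0 \<le> e"
    using m A q by (auto simp: r_def c_def e_def)
  have "sqrt (6 * q * A * m) = c * r"
    by (simp add: c_def r_def real_sqrt_mult)
  then have "q * (r * (r - c))\<^sup>2 \<le> s\<^sup>2 * A * r\<^sup>2"
    using le by (simp add: m_eq algebra_simps power2_eq_square)
  then have "(r - c)\<^sup>2 * q \<le> s\<^sup>2 * A"
    using r by (simp add: power_mult_distrib mult.commute mult.left_commute)
  then have "(r - c)\<^sup>2 \<le> s\<^sup>2 * A / q"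
    using q by (simp add: field_simps)
  also have e2: "\<dots> = e\<^sup>2"
    using A q by (simp add: e_def power_mult_distrib)
  finally have "\<bar>r - c\<bar> \<le> e" using e by (metis abs_le_square_iff abs_of_nonneg)
  then have "m \<le> (c + e)\<^sup>2"
    unfolding m_eq using r by (intro power_mono) auto
  also have "\<dots> = (6 * q * A + s\<^sup>2 * A / q) + 2 * (c * e)"
    unfolding e2 using A q by (simp add: c_def power2_sum)
  also have "c * e = sqrt 6 * (A * s)"
    using A q by (simp add: c_def e_def real_sqrt_mult real_sqrt_divide)
  also have "6 * q * A + s\<^sup>2 * A / q = A * (6 * q\<^sup>2 + s\<^sup>2) / q"
    using q by (simp add: field_simps power2_eq_square)
  also have "\<dots> \<le> A * (5 * s * q) / q"
  proof -
    \<comment> \<open>The window for \<open>q\<close> consists of the points between the roots of this quadratic.\<close>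
    have "(s - 2 * q) * (s - 3 * q) \<le> 0" using q by (intro mult_nonneg_nonpos) auto
    then have "6 * q\<^sup>2 + s\<^sup>2 \<le> 5 * s * q" by (simp add: algebra_simps power2_eq_square)
    then show ?thesis using A q by (intro divide_right_mono mult_left_mono) auto
  qed
  also have "\<dots> = 5 * (A * s)" using q by simp
  also have "sqrt 6 * (A * s) \<le> 5 / 2 * (A * s)"
    by (intro mult_right_mono real_le_lsqrt) (use A q in \<open>auto simp: power2_eq_square\<close>)
  finally show ?thesis by simp
qed

context connected_graph begin

definition variation :: "('v \<Rightarrow> real) \<Rightarrow> real" where
  "variation f = (\<Sum>y\<in>V. deg y * (f y - mean f)\<^sup>2)"

text \<open>
  In terms of the normalised Dirichlet form of the walk this says that the variance is at most \<open>T\<close>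
  times the form, so the least such \<open>T\<close> is the relaxation time.
\<close>

definition poincare :: "real \<Rightarrow> bool" where
  "poincare T \<longleftrightarrow> (\<forall>f. variation f \<le> T / 2 * energy f f)"

text \<open>
  In terms of the walk: \<open>(I - P) f \<le> 1\<close> off \<open>x\<close>. The truncated expectations
  \<open>E\<^sub>y min(\<tau>\<^sub>x, n)\<close> have this property for every \<open>n\<close>, before anything is known about the finiteness of
  \<open>E\<^sub>y \<tau>\<^sub>x\<close>.
\<close>

definition sub_hitting :: "'v \<Rightarrow> ('v \<Rightarrow> real) \<Rightarrow> bool" where
  "sub_hitting x f \<longleftrightarrow> f x = 0 \<and> (\<forall>y\<in>V. 0 \<le> f y) \<and> (\<forall>y\<in>V - {x}. lap f y \<le> 2 * deg y)"

text \<open>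
  The energy is at most \<open>2 vol mean f\<close>: the term at \<open>x\<close>, where the Laplacian is not controlled,
  vanishes because \<open>f x = 0\<close>.
\<close>

lemma energy_sub_hitting:
  assumes "sub_hitting x f" shows "energy f f \<le> 2 * wsum f"
  unfolding energy_def wsum_def sum_distrib_left
proof (rule sum_mono)
  fix y assume "y \<in> V"
  then show "f y * lap f y \<le> 2 * (deg y * f y)"
    using assms mult_left_mono[of "lap f y" "2 * deg y" "f y"]
    by (cases "y = x") (auto simp: sub_hitting_def algebra_simps)
qed

text \<open>
  An inequality form of Kac's formula. The Laplacian sums to zero, so its value at \<open>x\<close>, which is
  minus the sum of \<open>f\<close> over the neighbours, is determined by the values elsewhere.
\<close>

lemma sum_nb_sub_hitting:
  assumes "x \<in> V" "sub_hitting x f" shows "(\<Sum>z\<in>nb x. f z) \<le> 2 * vol"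
proof -
  have "(\<Sum>z\<in>nb x. f z) = - lap f x"
    using assms by (simp add: lap_eq sub_hitting_def)
  also have "\<dots> = (\<Sum>y\<in>V - {x}. lap f y)"
    using sum_lap[of f] sum.remove[OF finite_V assms(1), of "lap f"] by simp
  also have "\<dots> \<le> (\<Sum>y\<in>V - {x}. 2 * deg y)"
    using assms by (intro sum_mono) (auto simp: sub_hitting_def)
  also have "\<dots> \<le> (\<Sum>y\<in>V. 2 * deg y)"
    using finite_V by (intro sum_mono2) auto
  finally show ?thesis by (simp add: vol_def sum_distrib_left)
qed

text \<open>
  The central estimate. If the mean \<open>m\<close> were larger, then \<open>f\<close> would lie far below \<open>m\<close> on a
  set near \<open>x\<close> that is too big for the Poincare inequality. When \<open>\<surd>T \<le> 6 deg x\<close> this set is the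
  neighbourhood of \<open>x\<close>, by Kac's formula; otherwise it is a ball of radius of order
  \<open>\<surd>T / d\<close>, which then is at least one, by the bound along geodesics.
\<close>

lemma mean_sub_hitting_le:
  assumes x: "x \<in> V" and d: "0 < d" "\<And>y. y \<in> V \<Longrightarrow> d \<le> card (nb y)"
    and T: "0 \<le> T" "poincare T" and f: "sub_hitting x f"
  shows "mean f \<le> 10 * (vol / real d) * sqrt (T + 1)"
proof (rule ccontr)
  define m A s D where "m = mean f" and "A = vol / real d" and "s = sqrt T" and "D = deg x"
  assume "\<not> ?thesis"
  then have big: "10 * A * sqrt (T + 1) < m" by (simp add: m_def A_def)
  have dD: "real d \<le> deg y" if "y \<in> V" for y using d(2)[OF that] by (simp add: deg_def)
  have D: "real d \<le> D" "0 < D" using dD[OF x] d(1) by (auto simp: D_def)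
  have "D \<le> vol" unfolding D_def vol_def using x finite_V by (intro member_le_sum) auto
  then have vol: "0 < vol" using D by linarith
  have A: "0 < A" and vol_eq: "vol = A * d" using vol d by (auto simp: A_def)
  have s: "0 \<le> s" "s\<^sup>2 = T" using T by (auto simp: s_def)
  \<comment> \<open>The slack \<open>T + 1\<close> under the root absorbs the additive constant of the first case.\<close>
  have "(6 * s + 4)\<^sup>2 \<le> 100 * (T + 1)"
    using zero_le_power2[of "8 * s - 3"] unfolding s(2)[symmetric]
    by (simp add: power2_eq_square algebra_simps)
  then have "6 * s + 4 \<le> sqrt (100 * (T + 1))"
    using s(1) by (intro real_le_rsqrt) auto
  then have sqrt_T: "6 * s + 4 \<le> 10 * sqrt (T + 1)"
    using real_sqrt_mult[of 100 "T + 1"] by simp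
  then have "A * (6 * s + 4) \<le> A * (10 * sqrt (T + 1))" using A by (intro mult_left_mono) auto
  then have m_big: "6 * A * s + 4 * A < m" using big by (simp add: algebra_simps)
  have "A * s \<le> A * sqrt (T + 1)" unfolding s_def using A by (intro mult_left_mono) auto
  then have m_big2: "10 * A * s < m" using big by simp
  have m: "0 < m" using m_big A s mult_nonneg_nonneg[of A s] by linarith
  have wsum: "wsum f = vol * m" using vol by (simp add: m_def mean_def)
  have energy: "energy f f \<le> 2 * vol * m" using energy_sub_hitting[OF f] wsum by simp
  \<comment> \<open>Bounding weights below by \<open>d\<close> makes the counting measure of \<open>S\<close> available.\<close>
  have var: "(\<Sum>y\<in>S. (f y - m)\<^sup>2) \<le> T * A * m" if "S \<subseteq> V" for S
  proof -
    have "real d * (\<Sum>y\<in>S. (f y - m)\<^sup>2) \<le> real d * (\<Sum>y\<in>V. (f y - m)\<^sup>2)"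
      using that finite_V by (intro mult_left_mono sum_mono2) auto
    also have "\<dots> \<le> (\<Sum>y\<in>V. deg y * (f y - m)\<^sup>2)"
      unfolding sum_distrib_left using dD by (intro sum_mono mult_right_mono) auto
    also have "\<dots> \<le> T / 2 * energy f f" using T by (simp add: poincare_def variation_def m_def)
    also have "\<dots> \<le> T / 2 * (2 * vol * m)" using energy T by (intro mult_left_mono) auto
    also have "\<dots> = real d * (T * A * m)" by (simp add: vol_eq)
    finally show ?thesis using d(1) by simp
  qed
  have f0: "f x = 0" "\<And>y. y \<in> V \<Longrightarrow> 0 \<le> f y" using f by (auto simp: sub_hitting_def)
  have path: "(f y)\<^sup>2 \<le> real (gdist x y) * (2 * vol * m)" if "y \<in> V" for y
    using sq_diff_le_gdist_energy[OF x that, of f] f0(1)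
      mult_left_mono[OF energy, of "real (gdist x y)"] by simp
  show False
  proof (cases "s \<le> 6 * D")
    case True
    have "D * (m - 2 * A) \<le> (\<Sum>z\<in>nb x. m - f z)"
    proof -
      have "2 * vol \<le> 2 * A * D" unfolding vol_eq using D A by simp
      then show ?thesis
        using sum_nb_sub_hitting[OF x f] by (simp add: sum_subtractf D_def deg_def algebra_simps)
    qed
    then have "(D * (m - 2 * A))\<^sup>2 \<le> (\<Sum>z\<in>nb x. m - f z)\<^sup>2"
      using D m_big A s mult_nonneg_nonneg[of A s] by (intro power_mono mult_nonneg_nonneg) linarith+
    also have "\<dots> \<le> (\<Sum>z\<in>nb x. (f z - m)\<^sup>2) * D"
      using sum_squared_le_sum_of_squares[of "\<lambda>z. m - f z" "nb x"]
      by (simp add: D_def deg_def power2_commute)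
    also have "\<dots> \<le> (T * A * m) * D"
      using var[OF nb_subset[OF x]] D by (intro mult_right_mono) auto
    finally have "D * (D * (m - 2 * A)\<^sup>2) \<le> D * (T * A * m)"
      by (simp add: power2_eq_square algebra_simps)
    then have "D * (m - 2 * A)\<^sup>2 \<le> s * s * (A * m)"
      using D s by (simp add: power2_eq_square)
    also have "\<dots> \<le> s * (6 * D) * (A * m)"
      using True s A m by (intro mult_right_mono mult_left_mono) auto
    finally have "D * (m - 2 * A)\<^sup>2 \<le> D * (6 * s * A * m)" by (simp add: algebra_simps)
    then have "(m - 2 * A)\<^sup>2 \<le> 6 * s * A * m" using D by simp
    then have "m * (m - 4 * A) + 4 * A\<^sup>2 \<le> m * (6 * A * s)"
      by (simp add: power2_eq_square algebra_simps)
    then have "m * (m - 4 * A) \<le> m * (6 * A * s)"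
      using zero_le_power2[of A] by linarith
    then show False using m m_big by simp
  next
    case False
    \<comment> \<open>The number of disjoint neighbourhoods, chosen so that \<open>q = J d\<close> falls into \<open>[s / 3, s / 2]\<close>.\<close>
    define J where "J = nat \<lfloor>s / (2 * d)\<rfloor>"
    define q where "q = real J * d"
    have sd: "3 \<le> s / (2 * d)" using False D d by (simp add: field_simps)
    then have J: "3 \<le> J" "real J \<le> s / (2 * d)" "s / (2 * d) < real J + 1"
      unfolding J_def by linarith+
    have q: "0 < q" "2 * q \<le> s" "s \<le> 3 * q"
      using J d sd by (auto simp: q_def field_simps)
    \<comment> \<open>The ball has radius \<open>3 j + 1\<close>, which is \<open>3 J - 2\<close>.\<close>
    define j where "j = J - 1"
    have R: "real (3 * j + 1) * (2 * vol * m) \<le> 6 * q * A * m"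
    proof -
      have "3 * j + 1 \<le> 3 * J" using J(1) by (simp add: j_def)
      then have "real (3 * j + 1) \<le> real (3 * J)" by (rule of_nat_mono)
      then have "real (3 * j + 1) * (2 * vol * m) \<le> real (3 * J) * (2 * vol * m)"
        using vol m by (intro mult_right_mono) auto
      then show ?thesis by (simp add: q_def vol_eq algebra_simps)
    qed
    have near: "f y \<le> sqrt (6 * q * A * m)" if "y \<in> V" "gdist x y \<le> 3 * j + 1" for y
    proof (rule real_le_rsqrt)
      have "real (gdist x y) * (2 * vol * m) \<le> real (3 * j + 1) * (2 * vol * m)"
        using that vol m by (intro mult_right_mono of_nat_mono) auto
      then show "(f y)\<^sup>2 \<le> 6 * q * A * m" using path[OF that(1)] R by linarith
    qed
    have "6 * q * A * m < m\<^sup>2"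
    proof -
      have "6 * q * A \<le> 10 * A * s" using q A s by (simp add: algebra_simps)
      then have "6 * q * A < m" using m_big2 by linarith
      then show ?thesis using m by (simp add: power2_eq_square)
    qed
    then have b: "sqrt (6 * q * A * m) < m" using m by (simp add: real_less_lsqrt)
    show False
    proof (cases "\<exists>w\<in>V. 3 * j + 1 \<le> gdist x w")
      case False
      \<comment> \<open>The ball is the whole graph, so \<open>f\<close> is below its own mean everywhere.\<close>
      have "wsum f \<le> (\<Sum>y\<in>V. deg y * sqrt (6 * q * A * m))"
        unfolding wsum_def using False near by (intro sum_mono mult_left_mono) (auto simp: not_le)
      also have "\<dots> = vol * sqrt (6 * q * A * m)" by (simp add: vol_def sum_distrib_right)
      also have "\<dots> < vol * m" using b vol by simp
      finally show False using wsum by simp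
    next
      case True
      then obtain w where w: "w \<in> V" "3 * j + 1 \<le> gdist x w" by auto
      let ?B = "{y\<in>V. gdist x y \<le> 3 * j + 1}"
      have "q \<le> real (J * (d + 1))" by (simp add: q_def algebra_simps)
      also have "\<dots> \<le> real (card ?B)"
        using ball_growth[OF x d(2) w] J(1) by (intro of_nat_mono) (simp add: j_def)
      finally have "q * (m - sqrt (6 * q * A * m))\<^sup>2 \<le> real (card ?B) * (m - sqrt (6 * q * A * m))\<^sup>2"
        by (intro mult_right_mono) auto
      also have "\<dots> \<le> (\<Sum>y\<in>?B. (f y - m)\<^sup>2)"
      proof -
        have "(m - sqrt (6 * q * A * m))\<^sup>2 \<le> (f y - m)\<^sup>2" if "y \<in> ?B" for y
          using near[of y] that b power_mono[of "m - sqrt (6 * q * A * m)" "m - f y" 2]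
          by (simp add: power2_commute)
        then show ?thesis by (intro sum_bounded_below) auto
      qed
      also have "\<dots> \<le> s\<^sup>2 * A * m" unfolding s(2) by (intro var) auto
      finally show False using mean_bound_from_ball_estimate[OF A q m] m_big2 by simp
    qed
  qed
qed

text \<open>
  In terms of the walk: \<open>(I - P) h = 1\<close> off \<open>x\<close> with \<open>h x = 0\<close>, the first-step equations for
  \<open>E\<^sub>y \<tau>\<^sub>x\<close>.
\<close>

definition hitting_function :: "'v \<Rightarrow> ('v \<Rightarrow> real) \<Rightarrow> bool" where
  "hitting_function x h \<longleftrightarrow> h x = 0 \<and> (\<forall>y\<in>V - {x}. lap h y = 2 * deg y)"

text \<open>
  The Laplacian of \<open>h\<close> is \<open>2 deg\<close> minus a point mass at \<open>x\<close>, whose size \<open>2 vol\<close> is forced because the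
  Laplacian sums to zero. So, up to the mean, the energy pairing with \<open>h\<close> evaluates functions
  at \<open>x\<close>.
\<close>

lemma energy_hitting_function:
  assumes x: "x \<in> V" and h: "hitting_function x h"
  shows "energy f h = 2 * wsum f - 2 * vol * f x"
proof -
  have "lap h x = - (\<Sum>y\<in>V - {x}. lap h y)"
    using sum_lap[of h] sum.remove[OF finite_V x, of "lap h"] by simp
  also have "\<dots> = - (\<Sum>y\<in>V - {x}. 2 * deg y)"
    using h by (simp add: hitting_function_def)
  also have "\<dots> = 2 * deg x - 2 * vol"
    using sum.remove[OF finite_V x, of deg] by (simp add: vol_def sum_distrib_left[symmetric])
  finally have lap_h: "lap h y = 2 * deg y - (if y = x then 2 * vol else 0)" if "y \<in> V" for y
    using h that by (auto simp: hitting_function_def)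
  then have "energy f h = (\<Sum>y\<in>V. 2 * (deg y * f y) - (if y = x then 2 * vol * f x else 0))"
    unfolding energy_def by (intro sum.cong refl) (simp add: lap_h right_diff_distrib)
  then show ?thesis
    using finite_V x by (simp add: sum_subtractf wsum_def sum_distrib_left)
qed

text \<open>
  Pairing the two hitting functions expresses \<open>h y\<close> through their energy pairing, and
  nonnegativity of the energy of \<open>h + g\<close> bounds that pairing below by the two energies, which
  are multiples of the means.
\<close>

lemma hitting_function_le_means:
  assumes xy: "x \<in> V" "y \<in> V" and h: "hitting_function x h" "hitting_function y g"
    and vol: "0 < vol"
  shows "h y \<le> (3 * mean h + mean g) / 2"
proof -
  have 0: "h x = 0" "g y = 0" using h by (auto simp: hitting_function_def)
  have "energy h g = 2 * wsum h - 2 * vol * h y" "energy h h = 2 * wsum h" "energy g g = 2 * wsum g"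
    using energy_hitting_function[OF xy(2) h(2)] energy_hitting_function[OF xy(1) h(1)] 0 by auto
  moreover have "0 \<le> energy h h + 2 * 1 * energy h g + 1\<^sup>2 * energy g g"
    unfolding energy_add[symmetric] by (rule energy_nonneg)
  ultimately have "2 * vol * h y \<le> 3 * wsum h + wsum g" by simp
  then show ?thesis using vol by (simp add: mean_def field_simps)
qed

end

section \<open>The spectral gap of the Dirichlet form\<close>

lemma linear_coeff_zero:
  fixes a b :: real
  assumes "\<And>t. 0 \<le> a * t + b * t\<^sup>2" shows "a = 0"
proof (rule ccontr)
  assume "a \<noteq> 0"
  define k where "k = \<bar>b\<bar> + 1"
  have k: "0 < k" "b < k" by (auto simp: k_def)
  have "a * (- a / k) + b * (- a / k)\<^sup>2 = a\<^sup>2 * (b - k) / k\<^sup>2"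
    using k by (simp add: field_simps power2_eq_square)
  also have "\<dots> < 0"
    using k \<open>a \<noteq> 0\<close> by (intro divide_neg_pos mult_pos_neg) auto
  finally show False using assms[of "- a / k"] by simp
qed

context connected_graph begin

lemma variation_eq:
  assumes "0 < vol"
  shows "variation f = (\<Sum>y\<in>V. deg y * (f y)\<^sup>2) - (wsum f)\<^sup>2 / vol"
proof -
  have "variation f = (\<Sum>y\<in>V. deg y * (f y)\<^sup>2 - 2 * mean f * (deg y * f y) + (mean f)\<^sup>2 * deg y)"
    unfolding variation_def by (intro sum.cong refl) (simp add: power2_eq_square algebra_simps)
  also have "\<dots> = (\<Sum>y\<in>V. deg y * (f y)\<^sup>2) - 2 * mean f * wsum f + (mean f)\<^sup>2 * vol"
    by (simp add: sum.distrib sum_subtractf sum_distrib_left[symmetric] wsum_def vol_def)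
  also have "\<dots> = (\<Sum>y\<in>V. deg y * (f y)\<^sup>2) - (wsum f)\<^sup>2 / vol"
    using assms by (simp add: mean_def field_simps power2_eq_square)
  finally show ?thesis .
qed

lemma variation_nonneg: "0 \<le> variation f"
  unfolding variation_def by (intro sum_nonneg) auto

lemma energy_cong:
  assumes "\<And>y. y \<in> V \<Longrightarrow> f y = g y" shows "energy f f = energy g g"
  unfolding green using assms nb_subset by (intro arg_cong[of _ _ "\<lambda>u. u / 2"] sum.cong refl) (auto simp: subset_iff)

lemma energy_affine: "energy (\<lambda>y. (f y - a) / c) (\<lambda>y. (f y - a) / c) = energy f f / c\<^sup>2"
proof -
  have "(f y - a) / c - (f z - a) / c = (f y - f z) / c" for y z
    by (simp add: diff_divide_distrib)
  then show ?thesis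
    unfolding green by (simp add: power2_eq_square sum_divide_distrib ac_simps)
qed

lemma wsum_diff_mean: "0 < vol \<Longrightarrow> wsum (\<lambda>y. (f y - mean f) / c) = 0"
  by (simp add: wsum_def mean_def right_diff_distrib sum_subtractf sum_divide_distrib[symmetric]
      sum_distrib_right[symmetric] vol_def[symmetric] diff_divide_distrib)

text \<open>
  A function of zero variation equals its mean wherever the weight is positive.
\<close>

lemma variation_pos:
  assumes pos: "\<And>y. y \<in> V \<Longrightarrow> 0 < deg y" and ab: "a \<in> V" "b \<in> V" "f a \<noteq> f b"
  shows "0 < variation f"
proof (rule ccontr)
  assume "\<not> ?thesis"
  then have "variation f = 0" using variation_nonneg[of f] by simp
  then have "\<forall>y\<in>V. deg y * (f y - mean f)\<^sup>2 = 0"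
    unfolding variation_def using finite_V by (subst (asm) sum_nonneg_eq_0_iff) auto
  then have "f a = mean f" "f b = mean f" using pos ab by (force simp del: mult_eq_0_iff)+
  then show False using ab by simp
qed

text \<open>
  Minimise the energy over functions of mean zero and norm one, a compact set because \<open>V\<close> is
  finite. The form \<open>energy - 2 \<gamma> variation\<close> is nonnegative and vanishes at a minimiser \<open>f\<close>, so its
  first variation at \<open>f\<close> vanishes in the direction of every point mass; this is the
  eigenvalue equation. If \<open>\<gamma>\<close> were zero, then \<open>f\<close> would be constant because the graph is connected.
\<close>

lemma spectral_gap_exists:
  assumes pos: "\<And>y. y \<in> V \<Longrightarrow> 0 < deg y" and ab: "a \<in> V" "b \<in> V" "a \<noteq> b"
  obtains \<gamma> f c where "0 < \<gamma>" "\<And>g. 2 * \<gamma> * variation g \<le> energy g g"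
    "\<And>y. y \<in> V \<Longrightarrow> lap f y = 2 * \<gamma> * deg y * f y" "c \<in> V" "f c \<noteq> 0"
proof -
  have vol: "0 < vol" unfolding vol_def using pos ab finite_V by (intro sum_pos) auto
  define nrm where "nrm f = (\<Sum>y\<in>V. deg y * (f y)\<^sup>2)" for f
  \<comment> \<open>Functions are set to zero outside \<open>V\<close>, so that \<open>K\<close> is compact in the product topology.\<close>
  define K where "K = PiE UNIV (\<lambda>y. if y \<in> V then {-1..1::real} else {0}) \<inter> {f. wsum f = 0 \<and> nrm f = 1}"
  have cont: "continuous_on UNIV (\<lambda>f::'v \<Rightarrow> real. f y)" for y
    by simp
  have [continuous_intros]: "continuous_on S (\<lambda>f::'v \<Rightarrow> real. f y)" for y S
    using continuous_on_subset[OF cont] by blast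
  have "compact (PiE UNIV (\<lambda>y. if y \<in> V then {-1..1::real} else {0}))"
    using compactin_PiE[of "\<lambda>_. euclidean" UNIV "\<lambda>y. if y \<in> V then {-1..1::real} else {0}"]
    by (auto simp: euclidean_product_topology)
  moreover have "closed {f. wsum f = 0 \<and> nrm f = 1}"
    unfolding Collect_conj_eq wsum_def nrm_def
    by (intro closed_Int closed_Collect_eq continuous_intros)
  ultimately have "compact K" unfolding K_def by (rule compact_Int_closed)
  have scaled: "(\<lambda>y. if y \<in> V then (g y - mean g) / sqrt (variation g) else 0) \<in> K" (is "?h \<in> K")
    if g: "0 < variation g" for g
  proof -
    have n: "nrm ?h = 1"
      using g by (simp add: nrm_def power_divide sum_divide_distrib[symmetric] variation_def)
    have "wsum ?h = wsum (\<lambda>y. (g y - mean g) / sqrt (variation g))"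
      by (simp add: wsum_def)
    then have "wsum ?h = 0" using wsum_diff_mean[OF vol] by simp
    moreover have "?h y \<in> {-1..1}" if y: "y \<in> V" for y
    proof -
      have "1 \<le> deg y" using pos[OF y] by (simp add: deg_def)
      then have "1 * (?h y)\<^sup>2 \<le> deg y * (?h y)\<^sup>2" by (intro mult_right_mono) auto
      also have "\<dots> \<le> nrm ?h"
        unfolding nrm_def using y finite_V by (intro member_le_sum) auto
      finally have "(?h y)\<^sup>2 \<le> 1" using n by simp
      then show ?thesis by (simp add: abs_square_le_1 abs_le_iff)
    qed
    ultimately show ?thesis using n by (auto simp: K_def)
  qed
  have "0 < variation (\<lambda>y. if y = a then 1 else 0)"
    by (rule variation_pos[OF pos ab(1,2)]) (use ab in auto)
  then have "K \<noteq> {}" using scaled by blast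
  have "continuous_on K (\<lambda>f. energy f f)"
    unfolding green by (intro continuous_intros) simp_all
  then obtain f where f: "f \<in> K" and min: "\<And>g. g \<in> K \<Longrightarrow> energy f f \<le> energy g g"
    using continuous_attains_inf[OF \<open>compact K\<close> \<open>K \<noteq> {}\<close>] by blast
  define \<gamma> where "\<gamma> = energy f f / 2"
  have f_props: "wsum f = 0" "nrm f = 1" using f by (auto simp: K_def)
  have f_nz: "\<exists>c\<in>V. f c \<noteq> 0"
  proof (rule ccontr)
    assume "\<not> ?thesis"
    then have "nrm f = 0" by (simp add: nrm_def)
    then show False using f_props by simp
  qed
  then obtain c where c: "c \<in> V" "f c \<noteq> 0" by blast
  have gap: "2 * \<gamma> * variation g \<le> energy g g" for g
  proof (cases "variation g = 0")
    case False
    then have v: "0 < variation g" using variation_nonneg[of g] by simp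
    let ?h = "\<lambda>y. if y \<in> V then (g y - mean g) / sqrt (variation g) else 0"
    have "energy f f \<le> energy ?h ?h" by (rule min[OF scaled[OF v]])
    also have "\<dots> = energy (\<lambda>y. (g y - mean g) / sqrt (variation g)) (\<lambda>y. (g y - mean g) / sqrt (variation g))"
      by (rule energy_cong) simp
    also have "\<dots> = energy g g / variation g" using v by (simp add: energy_affine)
    finally show ?thesis using v by (simp add: \<gamma>_def field_simps)
  qed (simp add: energy_nonneg)
  have gap_pos: "0 < \<gamma>"
  proof (rule ccontr)
    assume "\<not> 0 < \<gamma>"
    then have "energy f f = 0" using energy_nonneg[of f] by (simp add: \<gamma>_def)
    then have const: "f y = f c" if "y \<in> V" for y
      using sq_diff_le_gdist_energy[OF c(1) that, of f] by simp
    have "wsum f = vol * f c"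
      by (simp add: wsum_def vol_def sum_distrib_right const)
    then show False using f_props vol c by simp
  qed
  have eigen: "lap f y = 2 * \<gamma> * deg y * f y" if y: "y \<in> V" for y
  proof -
    let ?g = "\<lambda>z. if z = y then 1 else (0::real)"
    have eg: "energy f ?g = lap f y"
      unfolding energy_commute[of f] using finite_V y by (simp add: energy_def if_distrib[of "\<lambda>u. u * _"] cong: if_cong)
    \<comment> \<open>This is the form at \<open>f + t g\<close>, expanded in powers of \<open>t\<close>.\<close>
    have "0 \<le> (2 * (lap f y - 2 * \<gamma> * deg y * f y)) * t
        + (energy ?g ?g - 2 * \<gamma> * (deg y - (deg y)\<^sup>2 / vol)) * t\<^sup>2" for t
    proof -
      let ?k = "\<lambda>z. f z + t * ?g z"
      have split: "\<And>z. F z * (if z = y then 1 else 0) = (if z = y then F z else (0::real))" for F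
        by simp
      have w: "wsum ?k = t * deg y"
        using f_props(1) finite_V y
        by (simp add: wsum_def distrib_left sum.distrib mult.left_commute[of _ t] split sum_distrib_left[symmetric])
      have "nrm ?k = (\<Sum>z\<in>V. deg z * (f z)\<^sup>2 + (if z = y then 2 * t * deg z * f z + t\<^sup>2 * deg z else 0))"
        unfolding nrm_def by (intro sum.cong refl) (simp add: power2_eq_square algebra_simps)
      also have "\<dots> = 1 + (2 * t * deg y * f y + t\<^sup>2 * deg y)"
        using f_props(2) finite_V y by (simp add: sum.distrib nrm_def)
      finally have n: "nrm ?k = 1 + (2 * t * deg y * f y + t\<^sup>2 * deg y)" .
      have "2 * \<gamma> * variation ?k \<le> 2 * \<gamma> + 2 * t * lap f y + t\<^sup>2 * energy ?g ?g"
        using gap[of ?k] unfolding energy_add eg by (simp add: \<gamma>_def)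
      moreover have "variation ?k = 1 + (2 * t * deg y * f y + t\<^sup>2 * deg y) - t\<^sup>2 * ((deg y)\<^sup>2 / vol)"
        unfolding variation_eq[OF vol] w n[unfolded nrm_def] by (simp add: power_mult_distrib)
      ultimately show ?thesis by (simp add: algebra_simps)
    qed
    from linear_coeff_zero[OF this] show ?thesis by simp
  qed
  show thesis by (rule that[OF gap_pos gap eigen c])
qed

end

text \<open>
  If all rows sum to one, replacing the first basis vector by the all-one vector makes the matrix
  block triangular. The remaining block is the action on functions modulo constants, identified with
  functions that vanish at the first index. So the algebraic multiplicity of the eigenvalue \<open>1\<close>
  can be controlled without a spectral theorem.
\<close>

lemma char_poly_deflate:
  fixes A :: "real mat"
  assumes A: "A \<in> carrier_mat (Suc k) (Suc k)"
    and rows: "\<And>i. i < Suc k \<Longrightarrow> (\<Sum>j<Suc k. A $$ (i, j)) = 1"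
  shows "char_poly A = [:-1, 1:] * char_poly (Matrix.mat k k (\<lambda>(i, j). A $$ (Suc i, Suc j) - A $$ (0, Suc j)))"
    (is "_ = _ * char_poly ?B")
proof -
  let ?n = "Suc k"
  \<comment> \<open>\<open>Q\<close> is the basis change, \<open>R\<close> its inverse, and \<open>M\<close> the matrix in the new basis.\<close>
  define Q where "Q = Matrix.mat ?n ?n (\<lambda>(i, j). if j = 0 \<or> i = j then 1 else (0::real))"
  define R where "R = Matrix.mat ?n ?n (\<lambda>(i, j). if i = j then 1 else if j = 0 then -1 else (0::real))"
  define M where "M = four_block_mat (1\<^sub>m 1) (Matrix.mat 1 k (\<lambda>(i, j). A $$ (0, Suc j))) (0\<^sub>m k 1) ?B"
  have carr: "Q \<in> carrier_mat ?n ?n" "R \<in> carrier_mat ?n ?n" "M \<in> carrier_mat ?n ?n"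
    by (auto simp: Q_def R_def M_def)
  have prod: "(X * Y) $$ (i, j) = (\<Sum>l<?n. X $$ (i, l) * Y $$ (l, j))"
    if "X \<in> carrier_mat ?n ?n" "Y \<in> carrier_mat ?n ?n" "i < ?n" "j < ?n" for X Y :: "real mat" and i j
    using that by (auto simp: scalar_prod_def lessThan_atLeast0)
  have Q: "Q $$ (i, j) = (if j = 0 \<or> i = j then 1 else 0)" if "i < ?n" "j < ?n" for i j
    using that by (simp add: Q_def)
  have R: "R $$ (i, j) = (if i = j then 1 else if j = 0 then -1 else 0)" if "i < ?n" "j < ?n" for i j
    using that by (simp add: R_def)
  have M: "M $$ (i, j) = (if j = 0 then (if i = 0 then 1 else 0) else
      if i = 0 then A $$ (0, j) else A $$ (i, j) - A $$ (0, j))" if "i < ?n" "j < ?n" for i j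
    using that by (auto simp: M_def)
  have Qmul: "(Q * Y) $$ (i, j) = (if i = 0 then Y $$ (0, j) else Y $$ (0, j) + Y $$ (i, j))"
    if "Y \<in> carrier_mat ?n ?n" "i < ?n" "j < ?n" for Y i j
  proof -
    have "(Q * Y) $$ (i, j) = (\<Sum>l<?n. (if l = 0 then Y $$ (0, j) else 0) + (if l = i \<and> i \<noteq> 0 then Y $$ (l, j) else 0))"
      unfolding prod[OF carr(1) that] using that by (intro sum.cong refl) (auto simp: Q)
    then show ?thesis
      using that by (cases "i = 0") (simp_all add: sum.distrib del: sum.lessThan_Suc)
  qed
  have QR: "Q * R = 1\<^sub>m ?n"
    using carr by (intro eq_matI) (auto simp: Qmul[OF carr(2)] R simp del: index_mult_mat(1))
  then have RQ: "R * Q = 1\<^sub>m ?n" by (rule mat_mult_left_right_inverse[OF carr(1,2)])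
  have "(A * Q) $$ (i, j) = (Q * M) $$ (i, j)" if ij: "i < ?n" "j < ?n" for i j
  proof (cases "j = 0")
    case True
    have "(A * Q) $$ (i, j) = 1"
      unfolding prod[OF A carr(1) ij] using True rows[OF ij(1)] by (simp add: Q del: sum.lessThan_Suc)
    then show ?thesis using True ij by (simp add: Qmul[OF carr(3)] M)
  next
    case False
    have "(A * Q) $$ (i, j) = (\<Sum>l<?n. if l = j then A $$ (i, l) else 0)"
      unfolding prod[OF A carr(1) ij] using False ij by (intro sum.cong refl) (auto simp: Q)
    then show ?thesis using False ij by (simp add: Qmul[OF carr(3)] M del: sum.lessThan_Suc)
  qed
  then have AQ: "A * Q = Q * M" using A carr by (intro eq_matI) auto
  have "A = A * (Q * R)" using A QR by simp
  also have "\<dots> = Q * M * R" unfolding AQ[symmetric] by (rule assoc_mult_mat[OF A carr(1,2), symmetric])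
  finally have "similar_mat A M"
    unfolding similar_mat_def similar_mat_wit_def using A carr QR RQ
    by (intro exI[of _ Q] exI[of _ R]) (auto simp: Let_def)
  then have "char_poly A = char_poly M" by (rule char_poly_similar)
  also have "\<dots> = char_poly (1\<^sub>m 1) * char_poly ?B"
    unfolding M_def by (intro char_poly_four_block_zeros_col) auto
  also have "char_poly (1\<^sub>m 1 :: real mat) = [:-1, 1:]"
    by (simp add: char_poly_defs det_def sign_def)
  finally show ?thesis .
qed

lemma second_largest_of_deflated:
  fixes N :: "real multiset"
  assumes "c \<in># N" "\<And>u. u \<in># N \<Longrightarrow> u \<le> c" "c \<le> b"
  shows "rev (sorted_list_of_multiset (add_mset b N)) ! 1 = c"
proof -
  let ?xs = "sorted_list_of_multiset N"
  have set_xs: "set ?xs = set_mset N" by simp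
  then have "?xs \<noteq> []" using assms(1) by (metis empty_iff list.set(1))
  then have xs: "set ?xs = set_mset N" "sorted ?xs" "?xs \<noteq> []" by simp_all
  have "\<forall>u\<in>set ?xs. u \<le> b" using assms(2,3) by fastforce
  then have "sorted_list_of_multiset (add_mset b N) = ?xs @ [b]"
    using sorted_insort_is_snoc[OF xs(2)] by simp
  then have "rev (sorted_list_of_multiset (add_mset b N)) ! 1 = hd (rev ?xs)"
    using xs by (simp add: hd_conv_nth)
  also have "\<dots> = last ?xs" by (simp add: hd_rev)
  also have "\<dots> = c"
  proof (rule antisym)
    show "last ?xs \<le> c" using assms(2) xs last_in_set by metis
    obtain i where "i < length ?xs" "?xs ! i = c" using assms(1) xs by (metis in_set_conv_nth)
    then show "c \<le> last ?xs"
      using sorted_nth_mono[OF xs(2), of i "length ?xs - 1"] xs(3) by (simp add: last_conv_nth)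
  qed
  finally show ?thesis .
qed

section \<open>The second eigenvalue of the walk\<close>

context connected_graph begin

definition walk :: "'v \<Rightarrow> 'v \<Rightarrow> real" where
  "walk y z = (if y = z then 1 / 2 else if z \<in> nb y then 1 / (2 * deg y) else 0)"

lemma walk_apply:
  assumes "y \<in> V" "0 < deg y"
  shows "(\<Sum>z\<in>V. walk y z * f z) = f y - lap f y / (2 * deg y)"
proof -
  have "(\<Sum>z\<in>V. walk y z * f z) = (\<Sum>z\<in>insert y (nb y). walk y z * f z)"
    using finite_V assms nb_subset[of y] by (intro sum.mono_neutral_right) (auto simp: walk_def)
  also have "\<dots> = f y / 2 + (\<Sum>z\<in>nb y. walk y z * f z)"
    using finite_nb assms nb_irrefl by (simp add: walk_def)
  also have "(\<Sum>z\<in>nb y. walk y z * f z) = (\<Sum>z\<in>nb y. f z) / (2 * deg y)"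
    unfolding sum_divide_distrib using nb_irrefl by (intro sum.cong refl) (auto simp: walk_def)
  finally show ?thesis using assms by (simp add: lap_eq field_simps)
qed

text \<open>
  Here \<open>f\<close> is an eigenvector modulo constants of the operator \<open>P f = f - lap f / (2 deg)\<close>. Summing the
  equation against the degrees determines \<open>c\<close>; then the energy of \<open>f\<close> is \<open>2 (1 - \<mu>)\<close> times its
  variation.
\<close>

lemma eigenvalue_mod_constants_le:
  assumes pos: "\<And>y. y \<in> V \<Longrightarrow> 0 < deg y" and vol: "0 < vol"
    and gap: "2 * \<gamma> * variation f \<le> energy f f" and var: "0 < variation f"
    and eig: "\<And>y. y \<in> V \<Longrightarrow> f y - lap f y / (2 * deg y) = \<mu> * f y + c"
  shows "\<mu> \<le> 1 - \<gamma>"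
proof -
  have lap: "lap f y = 2 * ((1 - \<mu>) * (deg y * f y) - c * deg y)" if "y \<in> V" for y
    using eig[OF that] pos[OF that] by (simp add: field_simps)
  have "0 = (\<Sum>y\<in>V. 2 * ((1 - \<mu>) * (deg y * f y) - c * deg y))"
    using sum_lap[of f] lap by simp
  also have "\<dots> = 2 * ((1 - \<mu>) * wsum f - c * vol)"
    by (simp only: wsum_def vol_def sum_distrib_left[symmetric] sum_subtractf)
  finally have c: "c = (1 - \<mu>) * wsum f / vol" using vol by (simp add: field_simps)
  have "energy f f = (\<Sum>y\<in>V. 2 * ((1 - \<mu>) * (deg y * (f y)\<^sup>2) - c * (deg y * f y)))"
    unfolding energy_def by (intro sum.cong refl) (simp add: lap power2_eq_square algebra_simps)
  also have "\<dots> = 2 * ((1 - \<mu>) * (\<Sum>y\<in>V. deg y * (f y)\<^sup>2) - c * wsum f)"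
    by (simp only: wsum_def sum_distrib_left[symmetric] sum_subtractf)
  also have "\<dots> = 2 * (1 - \<mu>) * variation f"
    unfolding variation_eq[OF vol] c by (simp add: algebra_simps power2_eq_square)
  finally have "2 * \<gamma> * variation f \<le> 2 * (1 - \<mu>) * variation f" using gap by simp
  then have "2 * \<gamma> \<le> 2 * (1 - \<mu>)" using var by (rule mult_right_le_imp_le)
  then show ?thesis by simp
qed

text \<open>
  The characteristic polynomial is \<open>X - 1\<close> times that of the deflated block. The number
  \<open>1 - \<gamma>\<close> is a root different from \<open>1\<close>, so it belongs to the block, and every real root of the block
  comes from an eigenvector modulo constants, so it is at most \<open>1 - \<gamma>\<close>.
\<close>

lemma second_eigenvalue_walk:
  assumes pos: "\<And>y. y \<in> V \<Longrightarrow> 0 < deg y" and n: "2 \<le> card V"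
    and vs: "distinct vs" "set vs = V"
    and A: "A = Matrix.mat (card V) (card V) (\<lambda>(i, j). walk (vs ! i) (vs ! j))"
  obtains \<gamma> where "0 < \<gamma>" "poincare (1 / \<gamma>)"
    "rev (sorted_list_of_multiset (proots (char_poly A))) ! 1 = 1 - \<gamma>"
proof -
  obtain k where k: "card V = Suc k" "0 < k" using n by (cases "card V") auto
  have len: "length vs = Suc k" using vs k distinct_card by fastforce
  then have nthV: "vs ! i \<in> V" if "i < Suc k" for i using that vs(2) nth_mem by metis
  have bij: "bij_betw ((!) vs) {..<Suc k} V" using vs len by (intro bij_betw_nth) simp_all
  have neq: "vs ! 0 \<noteq> vs ! Suc i" if "i < k" for i
    using that len nth_eq_iff_index_eq[OF vs(1), of 0 "Suc i"] by simp
  have carr: "A \<in> carrier_mat (Suc k) (Suc k)" by (simp add: A k)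
  have apply_A: "(\<Sum>j<Suc k. A $$ (i, j) * f (vs ! j)) = f (vs ! i) - lap f (vs ! i) / (2 * deg (vs ! i))"
    if i: "i < Suc k" for i f
  proof -
    have "(\<Sum>j<Suc k. A $$ (i, j) * f (vs ! j)) = (\<Sum>j<Suc k. walk (vs ! i) (vs ! j) * f (vs ! j))"
      using i by (intro sum.cong refl) (simp add: A k)
    also have "\<dots> = (\<Sum>z\<in>V. walk (vs ! i) z * f z)"
      by (rule sum.reindex_bij_betw[OF bij])
    finally show ?thesis using walk_apply[OF nthV[OF i] pos[OF nthV[OF i]]] by simp
  qed
  have rows: "(\<Sum>j<Suc k. A $$ (i, j)) = 1" if "i < Suc k" for i
    using apply_A[OF that, of "\<lambda>_. 1"] by (simp add: lap_def)
  define B where "B = Matrix.mat k k (\<lambda>(i, j). A $$ (Suc i, Suc j) - A $$ (0, Suc j))"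
  have B: "B \<in> carrier_mat k k" by (simp add: B_def)
  have cp: "char_poly A = [:-1, 1:] * char_poly B"
    unfolding B_def by (rule char_poly_deflate[OF carr rows])
  have cpB: "char_poly B \<noteq> 0" using degree_monic_char_poly[OF B] by auto
  have vol: "0 < vol" unfolding vol_def using pos k finite_V by (intro sum_pos) auto
  obtain \<gamma> f a where \<gamma>: "0 < \<gamma>" and gap: "\<And>g. 2 * \<gamma> * variation g \<le> energy g g"
    and f: "\<And>y. y \<in> V \<Longrightarrow> lap f y = 2 * \<gamma> * deg y * f y" and a: "a \<in> V" "f a \<noteq> 0"
    using spectral_gap_exists[OF pos nthV[of 0] nthV[of 1] neq[OF k(2), folded One_nat_def]] k(2)
    by (metis Suc_mono zero_less_Suc One_nat_def)
  have "eigenvector A (Matrix.vec (Suc k) (\<lambda>i. f (vs ! i))) (1 - \<gamma>)" (is "eigenvector A ?v _")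
  proof -
    obtain i where i: "i < Suc k" "a = vs ! i" using a vs(2) len by (metis in_set_conv_nth)
    have "?v \<noteq> 0\<^sub>v (Suc k)"
    proof
      assume "?v = 0\<^sub>v (Suc k)"
      then have "vec_index ?v i = vec_index (0\<^sub>v (Suc k)) i" by simp
      then show False using i a by simp
    qed
    moreover have "A *\<^sub>v ?v = (1 - \<gamma>) \<cdot>\<^sub>v ?v"
    proof (rule eq_vecI)
      fix i assume "i < dim_vec ((1 - \<gamma>) \<cdot>\<^sub>v ?v)"
      then have i: "i < Suc k" by simp
      have "vec_index (A *\<^sub>v ?v) i = (\<Sum>j<Suc k. A $$ (i, j) * f (vs ! j))"
        using i carr by (simp add: scalar_prod_def lessThan_atLeast0)
      also have "\<dots> = (1 - \<gamma>) * f (vs ! i)"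
        unfolding apply_A[OF i] using f[OF nthV[OF i]] pos[OF nthV[OF i]] by (simp add: field_simps)
      finally show "vec_index (A *\<^sub>v ?v) i = vec_index ((1 - \<gamma>) \<cdot>\<^sub>v ?v) i" using i by simp
    qed (use carr in simp)
    ultimately show ?thesis using carr by (simp add: eigenvector_def)
  qed
  then have "poly (char_poly A) (1 - \<gamma>) = 0"
    using eigenvalue_root_char_poly[OF carr] by (auto simp: eigenvalue_def)
  then have mem: "1 - \<gamma> \<in># proots (char_poly B)" using \<gamma> cpB by (simp add: cp)
  have max: "\<mu> \<le> 1 - \<gamma>" if "\<mu> \<in># proots (char_poly B)" for \<mu>
  proof -
    have "eigenvalue B \<mu>" using that cpB eigenvalue_root_char_poly[OF B] by simp
    then obtain w where w: "w \<in> carrier_vec k" "w \<noteq> 0\<^sub>v k" "B *\<^sub>v w = \<mu> \<cdot>\<^sub>v w"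
      using B by (auto simp: eigenvalue_def eigenvector_def)
    \<comment> \<open>Lift \<open>w\<close> to the function on \<open>V\<close> that vanishes at the first vertex.\<close>
    define u where "u i = (case i of 0 \<Rightarrow> 0 | Suc i' \<Rightarrow> vec_index w i')" for i
    define g where "g z = u (inv_into {..<Suc k} ((!) vs) z)" for z
    have g: "g (vs ! i) = u i" if "i < Suc k" for i
      unfolding g_def using that bij by (simp add: bij_betw_def inv_into_f_f)
    define c where "c = (\<Sum>j<Suc k. A $$ (0, j) * u j)"
    have Au: "(\<Sum>j<Suc k. A $$ (i, j) * u j) = \<mu> * u i + c" if i: "i < Suc k" for i
    proof (cases i)
      case 0
      then show ?thesis by (simp add: c_def u_def del: sum.lessThan_Suc)
    next
      case (Suc i')
      then have i': "i' < k" using i by simp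
      have "\<mu> * u i = vec_index (B *\<^sub>v w) i'" using w i' by (simp add: Suc u_def)
      also have "\<dots> = (\<Sum>j<k. (A $$ (i, Suc j) - A $$ (0, Suc j)) * vec_index w j)"
        using i' w(1) by (simp add: scalar_prod_def lessThan_atLeast0 B_def Suc)
      also have "\<dots> = (\<Sum>j<Suc k. A $$ (i, j) * u j) - c"
        unfolding c_def sum.lessThan_Suc_shift by (simp add: u_def left_diff_distrib sum_subtractf)
      finally show ?thesis by simp
    qed
    have "\<exists>i<k. vec_index w i \<noteq> 0"
    proof (rule ccontr)
      assume "\<not> ?thesis"
      then have "w = 0\<^sub>v k" using w(1) by (intro eq_vecI) auto
      then show False using w(2) by simp
    qed
    then obtain i where i: "i < k" "vec_index w i \<noteq> 0" by blast
    have "g (vs ! 0) \<noteq> g (vs ! Suc i)" using i by (simp add: g u_def)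
    then have var: "0 < variation g"
      using i by (intro variation_pos[OF pos nthV[of 0] nthV[of "Suc i"]]) auto
    show ?thesis
    proof (rule eigenvalue_mod_constants_le[OF pos vol gap var])
      fix y assume "y \<in> V"
      then obtain i where i: "i < Suc k" "y = vs ! i" using vs(2) len by (metis in_set_conv_nth)
      have "(\<Sum>j<Suc k. A $$ (i, j) * g (vs ! j)) = \<mu> * u i + c"
        unfolding Au[OF i(1), symmetric] by (intro sum.cong refl) (simp add: g)
      then show "g y - lap g y / (2 * deg y) = \<mu> * g y + c"
        using apply_A[OF i(1), of g] i g[OF i(1)] by simp
    qed
  qed
  have "proots (char_poly A) = add_mset 1 (proots (char_poly B))"
    unfolding cp using cpB by (subst proots_mult) auto
  then have "rev (sorted_list_of_multiset (proots (char_poly A))) ! 1 = 1 - \<gamma>"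
    using second_largest_of_deflated[OF mem max, of 1] \<gamma> by simp
  moreover have "poincare (1 / \<gamma>)"
    unfolding poincare_def using gap \<gamma> by (auto simp: field_simps)
  ultimately show thesis using that[OF \<gamma>] by simp
qed

end

section \<open>The bound on hitting times\<close>

context connected_graph begin

text \<open>
  The truncated expectations \<open>U n y = E\<^sub>y min(\<tau>\<^sub>x, n)\<close> increase with \<open>n\<close> and satisfy the recursion
  \<open>U (n + 1) = 1 + P (U n)\<close> off \<open>x\<close>. Together these make every \<open>U n\<close> sub-hitting, so the assumed
  bound on means applies uniformly in \<open>n\<close>. Hence the limit is finite, satisfies the exact
  equation, and inherits the bound.
\<close>

lemma expected_hitting_time_is_hitting_function:
  assumes K: "\<And>y z. y \<in> V \<Longrightarrow> pmf (K y) z = walk y z"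
    and pos: "\<And>y. y \<in> V \<Longrightarrow> 0 < deg y" and x: "x \<in> V"
    and bound: "\<And>f. sub_hitting x f \<Longrightarrow> mean f \<le> C"
  obtains h where "hitting_function x h" "mean h \<le> C"
    "\<And>y. y \<in> V \<Longrightarrow> 0 \<le> h y \<and> expected_hitting_time K y x = ennreal (h y)"
proof -
  define u where "u t y = (if y = x then 0 else stay_prob K (V - {x}) t y)" for t y
  define U where "U n y = (\<Sum>t<n. u t y)" for n y
  have vol: "0 < vol" unfolding vol_def using pos x finite_V by (intro sum_pos) auto
  have u_nonneg: "0 \<le> u t y" for t y by (simp add: u_def stay_prob_nonneg)
  have u_Suc: "u (Suc t) y = (\<Sum>z\<in>V. walk y z * u t z)" if "y \<in> V" "y \<noteq> x" for t y
  proof -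
    have "u (Suc t) y = (\<Sum>z\<in>V - {x}. walk y z * u t z)"
      using that by (simp add: u_def K)
    also have "\<dots> = (\<Sum>z\<in>V. walk y z * u t z)"
      using finite_V by (intro sum.mono_neutral_left) (auto simp: u_def)
    finally show ?thesis .
  qed
  have U_Suc: "U (Suc n) y = 1 + (U n y - lap (U n) y / (2 * deg y))" if y: "y \<in> V" "y \<noteq> x" for n y
  proof -
    have "U (Suc n) y = 1 + (\<Sum>t<n. \<Sum>z\<in>V. walk y z * u t z)"
      unfolding U_def sum.lessThan_Suc_shift using y by (simp add: u_Suc) (simp add: u_def)
    also have "\<dots> = 1 + (\<Sum>z\<in>V. walk y z * U n z)"
      unfolding U_def sum_distrib_left by (subst sum.swap) simp
    finally show ?thesis using walk_apply[OF y(1) pos[OF y(1)]] by simp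
  qed
  have U_sub: "sub_hitting x (U n)" for n
    unfolding sub_hitting_def
  proof (intro conjI ballI)
    show "U n x = 0" by (simp add: U_def u_def)
    show "0 \<le> U n y" for y by (simp add: U_def u_nonneg sum_nonneg)
    fix y assume y: "y \<in> V - {x}"
    have "U n y \<le> U (Suc n) y" by (simp add: U_def u_nonneg)
    then have "lap (U n) y / (2 * deg y) \<le> 1" using U_Suc[of y n] y by simp
    then show "lap (U n) y \<le> 2 * deg y" using pos[of y] y by (simp add: field_simps)
  qed
  have summable: "summable (\<lambda>t. u t y)" if y: "y \<in> V" for y
  proof (rule summableI_nonneg_bounded[OF u_nonneg])
    fix n
    have "deg y * U n y \<le> wsum (U n)"
      unfolding wsum_def using y finite_V U_sub[of n]
      by (intro member_le_sum) (auto simp: sub_hitting_def)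
    also have "\<dots> \<le> C * vol"
      using bound[OF U_sub[of n]] vol by (simp add: mean_def field_simps)
    finally show "(\<Sum>t<n. u t y) \<le> C * vol / deg y"
      using pos[OF y] by (simp add: U_def field_simps)
  qed
  define h where "h y = (\<Sum>t. u t y)" for y
  have lim: "(\<lambda>n. U n y) \<longlonglongrightarrow> h y" if "y \<in> V" for y
    unfolding U_def h_def by (rule summable_LIMSEQ[OF summable[OF that]])
  show thesis
  proof
    have "lap h y = 2 * deg y" if y: "y \<in> V" "y \<noteq> x" for y
    proof -
      have "(\<lambda>n. lap (U n) y) \<longlonglongrightarrow> lap h y"
        unfolding lap_def using y nb_subset[of y] by (intro tendsto_intros lim) auto
      then have "(\<lambda>n. U (Suc n) y) \<longlonglongrightarrow> 1 + (h y - lap h y / (2 * deg y))"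
        unfolding U_Suc[OF y] using pos[OF y(1)] by (intro tendsto_intros lim y(1)) auto
      moreover have "(\<lambda>n. U (Suc n) y) \<longlonglongrightarrow> h y"
        by (rule LIMSEQ_Suc[OF lim[OF y(1)]])
      ultimately have "1 + (h y - lap h y / (2 * deg y)) = h y" by (rule LIMSEQ_unique)
      then show ?thesis using pos[OF y(1)] by (simp add: field_simps)
    qed
    then show "hitting_function x h" by (simp add: hitting_function_def h_def u_def)
    have "(\<lambda>n. mean (U n)) \<longlonglongrightarrow> mean h"
      unfolding mean_def wsum_def using vol by (intro tendsto_intros lim) auto
    then show "mean h \<le> C"
      by (rule LIMSEQ_le_const2) (use bound[OF U_sub] in auto)
  next
    fix y assume y: "y \<in> V"
    have "set_pmf (K y) \<subseteq> V" if "y \<in> V" for y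
      using that nb_subset[OF that] by (auto simp: set_pmf_eq K walk_def split: if_splits)
    from expected_hitting_time_eq[OF finite_V this y, where x = x]
    have "expected_hitting_time K y x = (\<Sum>t. ennreal (u t y))" by (simp add: u_def)
    also have "\<dots> = ennreal (h y)"
      unfolding h_def using summable[OF y] by (intro suminf_ennreal_eq[OF u_nonneg] summable_sums)
    finally show "0 \<le> h y \<and> expected_hitting_time K y x = ennreal (h y)"
      using suminf_nonneg[OF summable[OF y] u_nonneg] by (simp add: h_def)
  qed
qed

lemma expected_hitting_time_le:
  assumes K: "\<And>y z. y \<in> V \<Longrightarrow> pmf (K y) z = walk y z"
    and d: "0 < d" "\<And>y. y \<in> V \<Longrightarrow> d \<le> card (nb y)"
    and T: "0 \<le> T" "poincare T" and xy: "x \<in> V" "y \<in> V"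
  shows "expected_hitting_time K y x \<le> ennreal (20 * (vol / real d) * sqrt (T + 1))"
proof -
  let ?C = "10 * (vol / real d) * sqrt (T + 1)"
  have pos: "0 < deg y" if "y \<in> V" for y using d(1) d(2)[OF that] by (simp add: deg_def)
  have vol: "0 < vol" unfolding vol_def using pos xy finite_V by (intro sum_pos) auto
  obtain h where h: "hitting_function x h" "mean h \<le> ?C"
      "\<And>y. y \<in> V \<Longrightarrow> 0 \<le> h y \<and> expected_hitting_time K y x = ennreal (h y)"
    using expected_hitting_time_is_hitting_function[OF K pos xy(1) mean_sub_hitting_le[OF xy(1) d T]] by blast
  obtain g where g: "hitting_function y g" "mean g \<le> ?C"
    using expected_hitting_time_is_hitting_function[OF K pos xy(2) mean_sub_hitting_le[OF xy(2) d T]] by blast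
  have "h y \<le> (3 * mean h + mean g) / 2"
    by (rule hitting_function_le_means[OF xy h(1) g(1) vol])
  also have "\<dots> \<le> 2 * ?C" using h(2) g(2) by simp
  finally show ?thesis using h(3)[OF xy(2)] by (simp add: ennreal_leI)
qed

end

lemma connected_graph_of_graph:
  assumes "graph G" "Digraph_Component.connected G"
  shows "connected_graph (verts G) (\<lambda>y. {z. y \<rightarrow>\<^bsub>G\<^esub> z})"
proof -
  interpret graph G by fact
  show ?thesis
  proof
    fix y z assume "y \<in> verts G" "z \<in> verts G"
    then have "y \<rightarrow>\<^sup>*\<^bsub>mk_symmetric G\<^esub> z"
      using assms(2) by (auto simp: connected_def)
    then have "y \<rightarrow>\<^sup>*\<^bsub>G\<^esub> z"
      using reachable_mk_symmetric_eq sym_arcs by metis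
    then show "(y, z) \<in> {(v, w). v \<in> verts G \<and> w \<in> {z. v \<rightarrow>\<^bsub>G\<^esub> z}}\<^sup>*"
      by (induction rule: reachable_induct) (auto intro: rtrancl_into_rtrancl dest: adj_in_verts)
  qed (use adj_not_same sym_arcs in \<open>auto simp: symmetric_def dest: adj_in_verts symD\<close>)
qed

theorem theorem1:
  fixes G :: "('a, 'b) pre_digraph"
  assumes "graph G"
    and "Digraph_Component.connected G"
    and "card (verts G) \<ge> 2"
  shows "t_hit G \<le>
    ennreal (20 * d_avg G / real (d_min G) * real (card (verts G)) * sqrt (t_rel G + 1))"
proof -
  interpret graph G by fact
  interpret connected_graph "verts G" "\<lambda>y. {z. y \<rightarrow>\<^bsub>G\<^esub> z}"
    by (rule connected_graph_of_graph[OF assms(1,2)])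
  have deg: "deg y = real (out_degree G y)" for y
    by (simp add: deg_def out_degree_eq_card_neighbours[OF assms(1)])
  have walk: "walk = lrw_prob G"
    by (simp add: fun_eq_iff walk_def lrw_prob_def deg)
  have pos: "0 < out_degree G y" if "y \<in> verts G" for y
    by (rule out_degree_pos[OF assms that])
  have ne: "verts G \<noteq> {}" using assms(3) by auto
  have d_pos: "0 < d_min G"
    unfolding d_min_def using finite_verts ne pos by simp
  have d_le: "d_min G \<le> card {z. y \<rightarrow>\<^bsub>G\<^esub> z}" if "y \<in> verts G" for y
    unfolding d_min_def out_degree_eq_card_neighbours[OF assms(1), symmetric] using finite_verts that by simp
  define vs where "vs = (SOME vs. distinct vs \<and> set vs = verts G)"
  have vs: "distinct vs" "set vs = verts G"
    using someI_ex[of "\<lambda>vs. distinct vs \<and> set vs = verts G"] finite_distinct_list[OF finite_verts]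
    unfolding vs_def by blast+
  have A: "lrw_matrix G = Matrix.mat (card (verts G)) (card (verts G)) (\<lambda>(i, j). walk (vs ! i) (vs ! j))"
    by (simp add: lrw_matrix_def walk vs_def Let_def)
  obtain \<gamma> where \<gamma>: "0 < \<gamma>" "poincare (1 / \<gamma>)" "lrw_eigenvalues G ! 1 = 1 - \<gamma>"
    using second_eigenvalue_walk[OF _ assms(3) vs A] pos unfolding lrw_eigenvalues_def by (auto simp: deg)
  have T: "t_rel G = 1 / \<gamma>" unfolding t_rel_def \<gamma>(3) by (simp add: inverse_eq_divide)
  have vol: "vol = d_avg G * real (card (verts G))"
    using assms(3) by (simp add: vol_def d_avg_def deg)
  have "expected_hitting_time (lrw_step G) y x \<le>
      ennreal (20 * d_avg G / real (d_min G) * real (card (verts G)) * sqrt (t_rel G + 1))"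
    if "x \<in> verts G" "y \<in> verts G" for x y
    using expected_hitting_time_le[of "lrw_step G" "d_min G" "t_rel G", OF _ d_pos d_le _ _ that] \<gamma>
      pmf_lrw_step[OF assms] by (simp add: walk T vol mult.assoc)
  moreover have "finite {expected_hitting_time (lrw_step G) y x |x y. x \<in> verts G \<and> y \<in> verts G}"
    by (rule finite_image_set2) simp_all
  moreover have "{expected_hitting_time (lrw_step G) y x |x y. x \<in> verts G \<and> y \<in> verts G} \<noteq> {}"
    using ne by blast
  ultimately show ?thesis
    unfolding t_hit_def by (subst Max_le_iff) auto
qed

end
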